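(* Let $f(x_1,x_2)=x_1+x_2+\sum_{i,j\ge1}\alpha_{ij}x_1^ix_2^j$, $\alpha_{ij}\in S^*$, be the unique series of this form in $S^*[[x_1,x_2]]$ which is a geometric cobordism element. Then $f$ determines a formal group on geometric cobordism elements; that is, $f$ is a one-dimensional (commutative) formal group law over $S^*$.
   Context: The Landweber–Novikov algebra $S$ is the Hopf algebra over $\mathbb Z$ defined as follows. Additively it is free abelian with basis $s_w$, where $w=(k_1,\dots,k_l)$ runs over finite unordered collections of positive integers including the empty one; $s_\emptyset=1$, and $s_w$ has degree $\deg w=2\sum_j k_j$. The coproduct is $\Delta s_w=\sum_{(w',w'')=w}s_{w'}\otimes s_{w''}$ (sum over splittings of the collection $w$ into two collections). On polynomial rings $\mathbb Z[y_1,\dots,y_N]$ the $s_w$ act by $s_{(k)}(y_j)=y_j^{k+1}$, $s_w(y_j)=0$ if $l>1$, and the Cartan formula $s_w(uv)=\sum_{(w',w'')=w}s_{w'}(u)s_{w''}(v)$; the product of $S$ is the unique one making these rings left $S$-modules for all $N$ (for every $s\in S$, $s\neq0$, one has $s(y_1\cdots y_N)\ne0$ for $N$ large). $S^*$ is the (graded) dual Hopf algebra: the polynomial ring over $\mathbb Z$ on generators $s_k^*$, $k\ge1$, where $(s_k^*,s_w)=1$ if $w=(k)$ and $0$ otherwise; it is graded in non-positive degrees, $\deg s_k^*=-2k$. $S$ acts on $S^*$ by $s(\lambda)=R_s^*(\lambda)$, where $(R_s^*(\lambda),s')=(\lambda,s's)$. A Milnor module over $S$ is a ring on which $S$ acts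 with $s(uv)=\sum s_i'(u)s_i''(v)$ whenever $\Delta s=\sum s_i'\otimes s_i''$. In a Milnor module, a geometric cobordism element is an element $x$ of degree $2$ with $s_{(k)}(x)=x^{k+1}$ for all $k\ge1$ and $s_w(x)=0$ for $w=(k_1,\dots,k_l)$, $l>1$. The power series ring $S^*[[x_1,x_2]]$ (variables of degree $2$) is a Milnor module via the action $R^*$ on $S^*$ and the requirement that the variables are geometric cobordism elements. It is known that a series $f$ as in the claim exists and is unique. *)

theory Defs
  imports "HOL-Library.Poly_Mapping" "HOL-Library.Multiset" "HOL-Library.Numeral_Type"
begin

section \<open>Splittings of collections\<close>

typedef pnat = "{n::nat. 0 < n}"
  by (rule exI[of _ 1]) simp

type_synonym collection = "pnat multiset"

text \<open>
  Ordered pairs of sub-multisets; a pair is counted once even if \<open>w\<close> has repeated entries.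
  With this convention the \<open>s\<^sub>w\<close> act like monomial symmetric functions and the dual ring is
  polynomial over the integers (rather than a divided power ring).
\<close>

definition splittings :: "'v multiset \<Rightarrow> ('v multiset \<times> 'v multiset) set" where
  "splittings w = {(w', w''). w' + w'' = w}"

lemma finite_splittings [simp, intro]: "finite (splittings w)"
proof -
  have "splittings w \<subseteq> (\<lambda>A. (A, w - A)) ` (\<Union>i\<le>size w. multisets_of_size (set_mset w) i)"
  proof
    fix z assume "z \<in> splittings w"
    then obtain A B where "z = (A, B)" "A + B = w"
      by (auto simp: splittings_def)
    moreover from this have "size A \<le> size w" "set_mset A \<subseteq> set_mset w" "w - A = B"
      by auto
    ultimately show "z \<in> (\<lambda>A. (A, w - A)) ` (\<Union>i\<le>size w. multisets_of_size (set_mset w) i)"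
      by (intro image_eqI[of _ _ A]) (simp_all add: multisets_of_size_def)
  qed
  thus ?thesis
    by (rule finite_subset) (simp add: finite_multisets_of_size)
qed

lemma splittings_empty [simp]: "splittings {#} = {({#}, {#})}"
  by (auto simp: splittings_def)

section \<open>Power series in several variables\<close>

text \<open>
  \<open>('v, 'a) mps\<close> is the ring of formal power series over \<open>'a\<close> in variables indexed by \<open>'v\<close>;
  a monomial is represented by the multiset of its variables, with repetition.
\<close>

typedef ('v, 'a) mps = "UNIV :: ('v multiset \<Rightarrow> 'a) set"
  morphisms mps_coeff Abs_mps by simp

lemma mps_coeff_Abs [simp]: "mps_coeff (Abs_mps f) = f"
  by (simp add: Abs_mps_inverse)

lemma mps_eqI: "(\<And>n. mps_coeff F n = mps_coeff G n) \<Longrightarrow> F = G"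
  by (metis ext mps_coeff_inverse)

instantiation mps :: (type, comm_ring_1) comm_ring_1
begin

definition "0 = Abs_mps (\<lambda>_. 0)"
definition "1 = Abs_mps (\<lambda>n. if n = {#} then 1 else 0)"
definition "F + G = Abs_mps (\<lambda>n. mps_coeff F n + mps_coeff G n)"
definition "F - G = Abs_mps (\<lambda>n. mps_coeff F n - mps_coeff G n)"
definition "- F = Abs_mps (\<lambda>n. - mps_coeff F n)"
definition
  "F * G = Abs_mps (\<lambda>n. \<Sum>(n', n'')\<in>splittings n. mps_coeff F n' * mps_coeff G n'')"

instance
proof
  fix F G H :: "('a, 'b) mps"
  show "F * G * H = F * (G * H)"
  proof (rule mps_eqI)
    fix n :: "'a multiset"
    let ?A = "SIGMA p:splittings n. splittings (fst p)"
    let ?B = "SIGMA p:splittings n. splittings (snd p)"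
    have "mps_coeff (F * G * H) n
        = (\<Sum>(p, q)\<in>?A. mps_coeff F (fst q) * mps_coeff G (snd q) * mps_coeff H (snd p))"
      by (simp add: times_mps_def case_prod_beta sum_distrib_right sum.Sigma)
    also have "\<dots> = (\<Sum>(p, q)\<in>?B. mps_coeff F (fst p) * (mps_coeff G (fst q) * mps_coeff H (snd q)))"
      by (rule sum.reindex_bij_witness
            [where i = "\<lambda>(p, q). ((fst p + fst q, snd q), (fst p, fst q))"
               and j = "\<lambda>(p, q). ((fst q, snd q + snd p), (snd q, snd p))"])
         (auto simp: splittings_def ac_simps)
    also have "\<dots> = mps_coeff (F * (G * H)) n"
      by (simp add: times_mps_def case_prod_beta sum_distrib_left sum.Sigma)
    finally show "mps_coeff (F * G * H) n = mps_coeff (F * (G * H)) n" .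
  qed
  show "F * G = G * F"
  proof (rule mps_eqI)
    fix n
    show "mps_coeff (F * G) n = mps_coeff (G * F) n"
      unfolding times_mps_def mps_coeff_Abs
      by (rule sum.reindex_bij_witness[where i = prod.swap and j = prod.swap])
         (auto simp: splittings_def ac_simps)
  qed
  show "1 * F = F"
  proof (rule mps_eqI)
    fix n
    have "mps_coeff (1 * F) n
        = (\<Sum>p\<in>splittings n. if p = ({#}, n) then mps_coeff F n else 0)"
      unfolding times_mps_def one_mps_def mps_coeff_Abs
      by (rule sum.cong) (auto simp: splittings_def split: if_splits)
    also have "\<dots> = mps_coeff F n"
      by (simp add: sum.delta) (simp add: splittings_def)
    finally show "mps_coeff (1 * F) n = mps_coeff F n" .
  qed
  show "(F + G) * H = F * H + G * H"
    by (rule mps_eqI)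
       (simp add: times_mps_def plus_mps_def case_prod_beta distrib_right sum.distrib)
  show "(0::('a, 'b) mps) \<noteq> 1"
  proof
    assume "(0::('a, 'b) mps) = 1"
    hence "mps_coeff (0::('a, 'b) mps) {#} = mps_coeff 1 {#}" by (rule arg_cong)
    thus False by (simp add: zero_mps_def one_mps_def)
  qed
qed (auto simp: zero_mps_def plus_mps_def minus_mps_def uminus_mps_def
       mps_coeff_inverse algebra_simps)

end

lemma mps_coeff_mult:
  "mps_coeff (F * G) n = (\<Sum>(n', n'')\<in>splittings n. mps_coeff F n' * mps_coeff G n'')"
  by (simp add: times_mps_def)

definition mps_var :: "'v \<Rightarrow> ('v, 'a::comm_ring_1) mps" where
  "mps_var v = Abs_mps (\<lambda>n. if n = {#v#} then 1 else 0)"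

lemma finite_multisets_of_bounded_size: "finite {n :: 'v::finite multiset. size n \<le> d}"
proof -
  have "{n :: 'v multiset. size n \<le> d} = (\<Union>i\<le>d. multisets_of_size UNIV i)"
    by (auto simp: multisets_of_size_def)
  thus ?thesis by (simp add: finite_multisets_of_size)
qed

text \<open>
  \<open>mps_subst F g\<close> substitutes \<open>g v\<close> for the variable \<open>v\<close> in \<open>F\<close>. It is only meaningful when every
  \<open>g v\<close> has zero constant term; then the monomials left out contribute nothing to the
  coefficient at \<open>m\<close>.
\<close>

definition mps_subst ::
    "('v::finite, 'a::comm_ring_1) mps \<Rightarrow> ('v \<Rightarrow> ('w, 'a) mps) \<Rightarrow> ('w, 'a) mps" where
  "mps_subst F g = Abs_mps (\<lambda>m. \<Sum>n | size n \<le> size m.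
     mps_coeff F n * mps_coeff (\<Prod>v\<in>#n. g v) m)"

definition pair_args :: "'b \<Rightarrow> 'b \<Rightarrow> 2 \<Rightarrow> 'b" where
  "pair_args a b = (\<lambda>v. if v = 0 then a else b)"

definition commutative_formal_group_law :: "(2, 'a::comm_ring_1) mps \<Rightarrow> bool" where
  "commutative_formal_group_law F \<longleftrightarrow>
     mps_subst F (pair_args (mps_var 0) 0) = (mps_var 0 :: (2, 'a) mps) \<and>
     mps_subst F (pair_args 0 (mps_var 1)) = (mps_var 1 :: (2, 'a) mps) \<and>
     mps_subst F (pair_args (mps_var 1) (mps_var 0)) = F \<and>
     mps_subst F (pair_args (mps_subst F (pair_args (mps_var 0) (mps_var 1))) (mps_var 2)) =
       (mps_subst F (pair_args (mps_var 0) (mps_subst F (pair_args (mps_var 1) (mps_var 2))))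
         :: (3, 'a) mps)"

section \<open>The Landweber--Novikov algebra\<close>

text \<open>
  The additive group of the algebra. The multiplication \<open>*\<close> that the library puts on this type is
  \<^emph>\<open>not\<close> the product of the Landweber--Novikov algebra, which is \<open>ln_times\<close> below.
\<close>

type_synonym ln = "collection \<Rightarrow>\<^sub>0 int"

definition ln_basis :: "collection \<Rightarrow> ln" where
  "ln_basis w = Poly_Mapping.single w 1"

definition ln_deg :: "collection \<Rightarrow> nat" where
  "ln_deg w = 2 * (\<Sum>k\<in>#w. Rep_pnat k)"

text \<open>
  For an element \<open>u\<close> of a ring, \<open>total_gen u\<close> collects into one series (with variables \<open>t\<^sub>k\<close>) the
  values on \<open>u\<close> of all \<open>s\<^sub>w\<close> when \<open>u\<close> behaves like a polynomial generator: \<open>u\<close> for empty \<open>w\<close>,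
  \<open>u ^ (k + 1)\<close> for \<open>w = (k)\<close>, and \<open>0\<close> for longer \<open>w\<close>. Series multiply by summing over splittings,
  so the Cartan formula says exactly that the coefficient of \<open>w\<close> in a product of such series is
  the value of \<open>s\<^sub>w\<close> on the product of the generators.
\<close>

definition total_gen :: "'a::comm_ring_1 \<Rightarrow> (pnat, 'a) mps" where
  "total_gen u = Abs_mps (\<lambda>w. if size w \<le> 1 then u ^ (1 + (\<Sum>k\<in>#w. Rep_pnat k)) else 0)"

definition monom_act :: "('v \<Rightarrow> 'a::comm_ring_1) \<Rightarrow> collection \<Rightarrow> 'v multiset \<Rightarrow> 'a" where
  "monom_act x w n = mps_coeff (\<Prod>v\<in>#n. total_gen (x v)) w"

lemma monom_act_single:
  "monom_act x {#} {#v#} = x v"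
  "monom_act x {#k#} {#v#} = x v ^ (Rep_pnat k + 1)"
  "1 < size w \<Longrightarrow> monom_act x w {#v#} = 0"
  by (simp_all add: monom_act_def total_gen_def)

lemma monom_act_empty: "monom_act x w {#} = (if w = {#} then 1 else 0)"
  by (simp add: monom_act_def one_mps_def)

lemma monom_act_Cartan:
  "monom_act x w (n + n') =
     (\<Sum>(w', w'')\<in>splittings w. monom_act x w' n * monom_act x w'' n')"
  by (simp add: monom_act_def mps_coeff_mult)

text \<open>Integer polynomials in variables \<open>y\<^sub>j\<close> indexed by the natural numbers.\<close>

type_synonym ipoly = "nat multiset \<Rightarrow>\<^sub>0 int"

definition ipoly_var :: "nat \<Rightarrow> ipoly" where
  "ipoly_var j = Poly_Mapping.single {#j#} 1"

definition ipoly_ring :: "nat \<Rightarrow> ipoly set" where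
  "ipoly_ring N = {p. \<forall>n\<in>Poly_Mapping.keys p. set_mset n \<subseteq> {1..N}}"

definition ipoly_act :: "ln \<Rightarrow> ipoly \<Rightarrow> ipoly" where
  "ipoly_act s p = (\<Sum>w\<in>Poly_Mapping.keys s. \<Sum>n\<in>Poly_Mapping.keys p.
     of_int (Poly_Mapping.lookup s w * Poly_Mapping.lookup p n) * monom_act ipoly_var w n)"

text \<open>
  The product: \<open>u\<close> is unique because the algebra acts faithfully on the polynomial rings, and the
  equation is the left module axiom.
\<close>

definition ln_times :: "ln \<Rightarrow> ln \<Rightarrow> ln" where
  "ln_times s t = (THE u. \<forall>N. \<forall>p\<in>ipoly_ring N. ipoly_act u p = ipoly_act s (ipoly_act t p))"

lemma poly_mapping_sum_monomials:
  "(\<Sum>n\<in>Poly_Mapping.keys p. Poly_Mapping.single n (Poly_Mapping.lookup p n)) = p"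
  by (rule poly_mapping_eqI)
     (auto simp: lookup_sum lookup_single when_def in_keys_iff sum.delta)

lemma ipoly_act_basis:
  "ipoly_act (ln_basis w) p =
     (\<Sum>n\<in>Poly_Mapping.keys p. of_int (Poly_Mapping.lookup p n) * monom_act ipoly_var w n)"
  by (simp add: ipoly_act_def ln_basis_def)

lemma ipoly_act_basis_superset:
  assumes "finite A" "Poly_Mapping.keys p \<subseteq> A"
  shows "ipoly_act (ln_basis w) p =
     (\<Sum>n\<in>A. of_int (Poly_Mapping.lookup p n) * monom_act ipoly_var w n)"
  unfolding ipoly_act_basis using assms
  by (intro sum.mono_neutral_left) (auto simp: in_keys_iff)

lemma ipoly_act_basis_add:
  "ipoly_act (ln_basis w) (p + q) = ipoly_act (ln_basis w) p + ipoly_act (ln_basis w) q"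
proof -
  let ?A = "Poly_Mapping.keys p \<union> Poly_Mapping.keys q"
  have "Poly_Mapping.keys (p + q) \<subseteq> ?A" by (rule Poly_Mapping.keys_add)
  thus ?thesis
    by (simp add: ipoly_act_basis_superset[of ?A] lookup_add distrib_right sum.distrib)
qed

lemma ipoly_act_basis_sum:
  "ipoly_act (ln_basis w) (\<Sum>i\<in>I. p i) = (\<Sum>i\<in>I. ipoly_act (ln_basis w) (p i))"
proof (induction I rule: infinite_finite_induct)
  case (insert i I)
  thus ?case by (simp add: ipoly_act_basis_add)
qed (simp_all add: ipoly_act_basis)

lemma ipoly_act_basis_single:
  "ipoly_act (ln_basis w) (Poly_Mapping.single n c) = of_int c * monom_act ipoly_var w n"
  by (cases "c = 0") (simp_all add: ipoly_act_basis)

lemma ipoly_act_var: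
  "ipoly_act (ln_basis {#k#}) (ipoly_var j) = ipoly_var j ^ (Rep_pnat k + 1)"
  "1 < size w \<Longrightarrow> ipoly_act (ln_basis w) (ipoly_var j) = 0"
proof -
  have "ipoly_act (ln_basis w) (ipoly_var j) = monom_act ipoly_var w {#j#}" for w
    unfolding ipoly_var_def[of j] by (simp only: ipoly_act_basis_single of_int_1 mult_1_left)
  thus "ipoly_act (ln_basis {#k#}) (ipoly_var j) = ipoly_var j ^ (Rep_pnat k + 1)"
    and "1 < size w \<Longrightarrow> ipoly_act (ln_basis w) (ipoly_var j) = 0"
    by (simp_all only: monom_act_single)
qed

lemma ipoly_act_Cartan:
  "ipoly_act (ln_basis w) (p * q) =
     (\<Sum>(w', w'')\<in>splittings w. ipoly_act (ln_basis w') p * ipoly_act (ln_basis w'') q)"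
proof -
  let ?P = "Poly_Mapping.keys p" and ?Q = "Poly_Mapping.keys q"
  let ?a = "Poly_Mapping.lookup p" and ?b = "Poly_Mapping.lookup q"
  have "p * q = (\<Sum>n\<in>?P. Poly_Mapping.single n (?a n)) * (\<Sum>m\<in>?Q. Poly_Mapping.single m (?b m))"
    by (simp add: poly_mapping_sum_monomials)
  also have "\<dots> = (\<Sum>n\<in>?P. \<Sum>m\<in>?Q. Poly_Mapping.single (n + m) (?a n * ?b m))"
    by (simp add: sum_product mult_single)
  finally have "ipoly_act (ln_basis w) (p * q) =
      (\<Sum>n\<in>?P. \<Sum>m\<in>?Q. of_int (?a n * ?b m) * monom_act ipoly_var w (n + m))"
    by (simp add: ipoly_act_basis_sum ipoly_act_basis_single)
  also have "\<dots> = (\<Sum>n\<in>?P. \<Sum>m\<in>?Q. \<Sum>z\<in>splittings w.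
      (of_int (?a n) * monom_act ipoly_var (fst z) n) *
      (of_int (?b m) * monom_act ipoly_var (snd z) m))"
    by (simp add: monom_act_Cartan sum_distrib_left case_prod_beta mult_ac)
  also have "\<dots> = (\<Sum>z\<in>splittings w. \<Sum>n\<in>?P. \<Sum>m\<in>?Q.
      (of_int (?a n) * monom_act ipoly_var (fst z) n) *
      (of_int (?b m) * monom_act ipoly_var (snd z) m))"
    by (subst sum.swap[of _ _ ?Q], subst sum.swap[of _ _ ?P]) (rule refl)
  finally show ?thesis
    by (simp add: ipoly_act_basis sum_product case_prod_beta)
qed

section \<open>The dual\<close>

text \<open>
  The graded dual, with the multiplication \<open>*\<close> of the library. This is the integer polynomial
  ring on the generators \<open>s\<^sub>k\<^sup>*\<close>, whose monomials form the basis dual to the \<open>s\<^sub>w\<close>.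
\<close>

type_synonym ln_dual = "collection \<Rightarrow>\<^sub>0 int"

definition dual_gen :: "pnat \<Rightarrow> ln_dual" where
  "dual_gen k = Poly_Mapping.single {#k#} 1"

definition pairing :: "ln_dual \<Rightarrow> ln \<Rightarrow> int" where
  "pairing l s = (\<Sum>w\<in>Poly_Mapping.keys s. Poly_Mapping.lookup l w * Poly_Mapping.lookup s w)"

lemma pairing_basis: "pairing l (ln_basis w) = Poly_Mapping.lookup l w"
  by (simp add: pairing_def ln_basis_def)

lemma pairing_dual_gen: "pairing (dual_gen k) (ln_basis w) = (if w = {#k#} then 1 else 0)"
  by (auto simp: pairing_basis dual_gen_def lookup_single)

lemma dual_monomial: "(\<Prod>k\<in>#w. dual_gen k) = Poly_Mapping.single w 1"
  by (induction w) (simp_all add: dual_gen_def mult_single)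

lemma pairing_times:
  "pairing (l * m) (ln_basis w) =
     (\<Sum>(w', w'')\<in>splittings w. pairing l (ln_basis w') * pairing m (ln_basis w''))"
proof -
  let ?L = "Poly_Mapping.keys l" and ?M = "Poly_Mapping.keys m"
  let ?a = "Poly_Mapping.lookup l" and ?b = "Poly_Mapping.lookup m"
  have "l * m = (\<Sum>n\<in>?L. Poly_Mapping.single n (?a n)) * (\<Sum>k\<in>?M. Poly_Mapping.single k (?b k))"
    by (simp add: poly_mapping_sum_monomials)
  also have "\<dots> = (\<Sum>z\<in>?L \<times> ?M. Poly_Mapping.single (fst z + snd z) (?a (fst z) * ?b (snd z)))"
    by (simp add: sum_product mult_single sum.cartesian_product case_prod_beta)
  finally have "Poly_Mapping.lookup (l * m) w =
      (\<Sum>z\<in>?L \<times> ?M. if fst z + snd z = w then ?a (fst z) * ?b (snd z) else 0)"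
    by (simp add: lookup_sum lookup_single when_def)
  also have "\<dots> = (\<Sum>z\<in>(?L \<times> ?M) \<inter> splittings w. ?a (fst z) * ?b (snd z))"
    by (rule sum.mono_neutral_cong_right) (auto simp: splittings_def)
  also have "\<dots> = (\<Sum>z\<in>splittings w. ?a (fst z) * ?b (snd z))"
    by (rule sum.mono_neutral_left) (auto simp: in_keys_iff)
  finally show ?thesis by (simp add: pairing_basis case_prod_beta)
qed

definition dual_homogeneous :: "int \<Rightarrow> ln_dual \<Rightarrow> bool" where
  "dual_homogeneous d l \<longleftrightarrow> (\<forall>w\<in>Poly_Mapping.keys l. - int (ln_deg w) = d)"

text \<open>The defining equation is \<open>(R\<^sub>s\<^sup>*(l), s') = (l, s' s)\<close>; the pairing determines \<open>m\<close>.\<close>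

definition dual_act :: "ln \<Rightarrow> ln_dual \<Rightarrow> ln_dual" where
  "dual_act s l = (THE m. \<forall>s'. pairing m s' = pairing l (ln_times s' s))"

section \<open>Power series over the dual and geometric cobordism elements\<close>

text \<open>
  \<open>s\<^sub>w\<close> applied to a sum of terms \<open>c\<^sub>n x\<^sup>n\<close> is the sum over \<open>n\<close> and over splittings of \<open>w\<close> of
  \<open>s\<^sub>w\<^sub>' (c\<^sub>n) s\<^sub>w\<^sub>'\<^sub>' (x\<^sup>n)\<close>. As \<open>s\<^sub>w\<^sub>'\<^sub>' (x\<^sup>n)\<close> has no monomials of size below that of \<open>n\<close>, only
  finitely many \<open>n\<close> matter for the coefficient at \<open>m\<close>.
\<close>

definition series_act :: "ln \<Rightarrow> ('v::finite, ln_dual) mps \<Rightarrow> ('v, ln_dual) mps" where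
  "series_act s F = Abs_mps (\<lambda>m. \<Sum>w\<in>Poly_Mapping.keys s. of_int (Poly_Mapping.lookup s w) *
     (\<Sum>n | size n \<le> size m. \<Sum>(w', w'')\<in>splittings w.
        dual_act (ln_basis w') (mps_coeff F n) * mps_coeff (monom_act mps_var w'' n) m))"

definition series_homogeneous :: "int \<Rightarrow> ('v, ln_dual) mps \<Rightarrow> bool" where
  "series_homogeneous d F \<longleftrightarrow> (\<forall>n. dual_homogeneous (d - 2 * int (size n)) (mps_coeff F n))"

text \<open>Here \<open>A2\<close> is the set of elements of degree 2 of the graded ring acted upon.\<close>

definition geometric_cobordism ::
    "(ln \<Rightarrow> 'a::comm_ring_1 \<Rightarrow> 'a) \<Rightarrow> 'a set \<Rightarrow> 'a \<Rightarrow> bool" where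
  "geometric_cobordism act A2 x \<longleftrightarrow>
     x \<in> A2 \<and>
     (\<forall>k. act (ln_basis {#k#}) x = x ^ (Rep_pnat k + 1)) \<and>
     (\<forall>w. 1 < size w \<longrightarrow> act (ln_basis w) x = 0)"

text \<open>\<open>x\<^sub>1\<close> and \<open>x\<^sub>2\<close> are \<open>mps_var 0\<close> and \<open>mps_var 1\<close>.\<close>

definition normalized_series :: "(nat \<Rightarrow> nat \<Rightarrow> 'a::comm_ring_1) \<Rightarrow> (2, 'a) mps" where
  "normalized_series \<alpha> = mps_var 0 + mps_var 1 +
     Abs_mps (\<lambda>n. if 1 \<le> count n 0 \<and> 1 \<le> count n 1 then \<alpha> (count n 0) (count n 1) else 0)"

end

theory Submission
  imports Defs
begin

text \<open>
  Let \<open>\<epsilon>\<close> be the augmentation of the dual, i.e. pairing with \<open>1\<close>. Then \<open>\<epsilon> (s\<^sub>w \<lambda>) = (\<lambda>, s\<^sub>w)\<close>, so the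
  values \<open>\<epsilon> (s\<^sub>w \<lambda>)\<close> determine \<open>\<lambda>\<close>. Put \<open>\<phi>(x) = x + s\<^sub>1\<^sup>* x\<^sup>2 + s\<^sub>2\<^sup>* x\<^sup>3 + \<dots>\<close>. Applying \<open>\<epsilon>\<close> to the
  coefficients of the equations \<open>s\<^sub>(\<^sub>k\<^sub>) f = f ^ (k + 1)\<close>, \<open>s\<^sub>w f = 0\<close> and collecting them over all \<open>w\<close>
  gives \<open>f(\<phi>(x\<^sub>1), \<phi>(x\<^sub>2)) = \<phi>(\<epsilon> f)\<close>, and \<open>\<epsilon> f = x\<^sub>1 + x\<^sub>2\<close> because \<open>f\<close> has degree 2. So \<open>\<phi>\<close> is an
  exponential of \<open>f\<close>: after the injective substitution \<open>x\<^sub>i \<mapsto> \<phi>(x\<^sub>i)\<close> each axiom becomes an identity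
  between sums of variables.

  The formula for \<open>\<epsilon> (s\<^sub>w \<lambda>)\<close> presupposes that the product of the Landweber--Novikov algebra exists and
  is graded. Its structure constants are read off from the composition of the two
  substitutions \<open>y \<mapsto> y + t\<^sub>1 y\<^sup>2 + \<dots>\<close> and \<open>y \<mapsto> y + t\<^sub>1' y\<^sup>2 + \<dots>\<close>.
\<close>

section \<open>Coefficients\<close>

lemma mps_coeff_zero [simp]: "mps_coeff 0 n = 0"
  by (simp add: zero_mps_def)

lemma mps_coeff_one: "mps_coeff 1 n = (if n = {#} then 1 else 0)"
  by (simp add: one_mps_def)

lemma mps_coeff_add [simp]: "mps_coeff (F + G) n = mps_coeff F n + mps_coeff G n"
  by (simp add: plus_mps_def)

lemma mps_coeff_sum: "mps_coeff (\<Sum>i\<in>I. F i) n = (\<Sum>i\<in>I. mps_coeff (F i) n)"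
  by (induction I rule: infinite_finite_induct) simp_all

lemma lookup_of_int_mult:
  fixes p :: "'v multiset \<Rightarrow>\<^sub>0 int"
  shows "Poly_Mapping.lookup (of_int c * p) w = c * Poly_Mapping.lookup p w"
proof -
  have "of_int c * p = Poly_Mapping.map ((*) c) p"
    by (metis mult_map_scale_conv_mult single_of_int of_int_eq_id id_apply)
  thus ?thesis by (simp add: Poly_Mapping.map.rep_eq when_def)
qed

lemma lookup_mult_multiset:
  fixes p q :: "'v multiset \<Rightarrow>\<^sub>0 int"
  shows "Poly_Mapping.lookup (p * q) w =
    (\<Sum>(w', w'')\<in>splittings w. Poly_Mapping.lookup p w' * Poly_Mapping.lookup q w'')"
proof -
  let ?a = "Poly_Mapping.lookup p" and ?b = "Poly_Mapping.lookup q"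
  let ?K = "Poly_Mapping.keys p \<times> Poly_Mapping.keys q"
  have "p * q = (\<Sum>n\<in>Poly_Mapping.keys p. Poly_Mapping.single n (?a n)) *
      (\<Sum>k\<in>Poly_Mapping.keys q. Poly_Mapping.single k (?b k))"
    by (simp add: poly_mapping_sum_monomials)
  also have "\<dots> = (\<Sum>z\<in>?K. Poly_Mapping.single (fst z + snd z) (?a (fst z) * ?b (snd z)))"
    by (simp add: sum_product mult_single sum.cartesian_product case_prod_beta)
  finally have "Poly_Mapping.lookup (p * q) w =
      (\<Sum>z\<in>?K. if fst z + snd z = w then ?a (fst z) * ?b (snd z) else 0)"
    by (simp add: lookup_sum lookup_single when_def)
  also have "\<dots> = (\<Sum>z\<in>?K \<inter> splittings w. ?a (fst z) * ?b (snd z))"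
    by (rule sum.mono_neutral_cong_right) (auto simp: splittings_def)
  also have "\<dots> = (\<Sum>z\<in>splittings w. ?a (fst z) * ?b (snd z))"
    by (rule sum.mono_neutral_left) (auto simp: in_keys_iff)
  finally show ?thesis by (simp add: case_prod_beta)
qed

section \<open>Weights\<close>

text \<open>Half of \<open>ln_deg\<close>. The grading arguments use this number because exponents
  of generators change by exactly it.\<close>

definition weight :: "collection \<Rightarrow> nat" where
  "weight w = (\<Sum>k\<in>#w. Rep_pnat k)"

lemma Rep_pnat_pos [simp]: "0 < Rep_pnat k"
  using Rep_pnat by simp

lemma Rep_pnat_neq_0 [simp]: "Rep_pnat k \<noteq> 0"
  using Rep_pnat_pos[of k] by (simp del: Rep_pnat_pos)

lemma weight_simps [simp]:
  "weight {#} = 0" "weight (add_mset k w) = Rep_pnat k + weight w"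
  "weight (w + w') = weight w + weight w'"
  by (simp_all add: weight_def)

lemma size_le_weight: "size w \<le> weight w"
proof (induction w)
  case (add k w)
  thus ?case using Rep_pnat_pos[of k] by (simp del: Rep_pnat_pos)
qed simp

lemma weight_eq_0_iff [simp]: "weight w = 0 \<longleftrightarrow> w = {#}"
  using size_le_weight[of w] by auto

text \<open>Entries are positive, so both the number of entries and each entry are at most
  \<open>d\<close>. Sums cut off by weight are therefore finite.\<close>

lemma finite_weight_le [simp]: "finite {w. weight w \<le> d}"
proof -
  let ?A = "{k. Rep_pnat k \<le> d}"
  have fin: "finite ?A"
    by (rule inj_on_finite[of Rep_pnat _ "{..d}"]) (auto intro: inj_onI simp: Rep_pnat_inject)
  have le: "Rep_pnat k \<le> weight w" if "k \<in># w" for k w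
    using that by (metis insert_DiffM le_add1 weight_simps(2))
  have "{w. weight w \<le> d} \<subseteq> (\<Union>i\<le>d. multisets_of_size ?A i)"
  proof
    fix w assume "w \<in> {w. weight w \<le> d}"
    hence w: "weight w \<le> d" by simp
    have "set_mset w \<subseteq> ?A" using le w order_trans by blast
    moreover have "size w \<le> d" using size_le_weight w order_trans by blast
    ultimately show "w \<in> (\<Union>i\<le>d. multisets_of_size ?A i)"
      by (simp add: multisets_of_size_def)
  qed
  thus ?thesis by (rule finite_subset) (simp add: finite_multisets_of_size fin)
qed

lemma mps_coeff_total_gen:
  "mps_coeff (total_gen u) w = (if size w \<le> 1 then u ^ (1 + weight w) else 0)"
  by (simp add: total_gen_def weight_def)

lemma size_le_1_cases:
  assumes "size w \<le> 1" obtains "w = {#}" | k where "w = {#k#}"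
  using assms by (cases w) auto

text \<open>Every nonzero summand of the coefficient at \<open>w\<close> carries the same power of
  \<open>u\<close>, as weights add along splittings. The integer factor is the value at
  \<open>u = 1\<close>.\<close>

lemma mps_coeff_total_gen_power:
  "mps_coeff (total_gen u ^ r) w = of_int (mps_coeff (total_gen 1 ^ r) w) * u ^ (r + weight w)"
proof (induction r arbitrary: w)
  case 0
  show ?case by (auto simp: mps_coeff_one)
next
  case (Suc r)
  have "mps_coeff (total_gen u) w' * mps_coeff (total_gen u ^ r) w'' =
     of_int (mps_coeff (total_gen 1) w' * mps_coeff (total_gen 1 ^ r) w'') * u ^ (Suc r + weight w)"
    if "w' + w'' = w" for w' w''
    using that[symmetric] by (simp add: mps_coeff_total_gen Suc.IH[of w''] power_add ac_simps)
  thus ?case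
    unfolding power_Suc mps_coeff_mult of_int_sum sum_distrib_right
    by (intro sum.cong refl) (auto simp: splittings_def)
qed

section \<open>Existence of the product\<close>

lemma monom_act_replicate: "monom_act x w (replicate_mset r v) = mps_coeff (total_gen (x v) ^ r) w"
  by (simp add: monom_act_def)

lemma monom_act_empty_collection: "monom_act x {#} n = (\<Prod>v\<in>#n. x v)"
proof (induction n)
  case (add v n)
  show ?case
    using monom_act_Cartan[of x "{#}" "{#v#}" n] add by (simp add: monom_act_single)
qed (simp add: monom_act_empty)

lemma prod_ipoly_var: "(\<Prod>v\<in>#n. ipoly_var v) = Poly_Mapping.single n 1"
  by (induction n) (simp_all add: ipoly_var_def mult_single)

lemma ipoly_act_one: "ipoly_act (ln_basis {#}) p = p"
proof -
  have "of_int c * Poly_Mapping.single n 1 = Poly_Mapping.single n c" for n :: "nat multiset" and c :: int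
    by (rule poly_mapping_eqI) (simp add: lookup_of_int_mult lookup_single when_def)
  thus ?thesis
    by (simp add: ipoly_act_basis monom_act_empty_collection prod_ipoly_var
        poly_mapping_sum_monomials)
qed

lemma ipoly_act_basis_of_int_mult:
  "ipoly_act (ln_basis w) (of_int c * p) = of_int c * ipoly_act (ln_basis w) p"
proof -
  have "Poly_Mapping.keys (of_int c * p) \<subseteq> Poly_Mapping.keys p"
    by (auto simp: in_keys_iff lookup_of_int_mult)
  from ipoly_act_basis_superset[OF finite_keys this, of w] show ?thesis
    unfolding ipoly_act_basis[of w p] by (simp add: lookup_of_int_mult sum_distrib_left mult.assoc)
qed

text \<open>The number \<open>c\<close> with \<open>s\<^sub>w (s\<^sub>w\<^sub>' y) = c y ^ (1 + weight w + weight w')\<close> for every variable \<open>y\<close>.\<close>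

definition comp_coeff :: "collection \<Rightarrow> collection \<Rightarrow> int" where
  "comp_coeff w w' =
     (if size w' \<le> 1 then mps_coeff (total_gen 1 ^ (1 + weight w')) w else 0)"

lemma ipoly_act_monom_act_var:
  "ipoly_act (ln_basis w) (monom_act ipoly_var w' {#v#}) =
     of_int (comp_coeff w w') * ipoly_var v ^ (1 + weight w + weight w')"
proof (cases "size w' \<le> 1")
  case True
  have "ipoly_act (ln_basis w) (ipoly_var v ^ r) = mps_coeff (total_gen (ipoly_var v) ^ r) w" for r
    using ipoly_act_basis_single[of w "replicate_mset r v" 1] prod_ipoly_var[of "replicate_mset r v"]
    by (simp add: monom_act_replicate)
  moreover have "monom_act ipoly_var w' {#v#} = ipoly_var v ^ (1 + weight w')"
    using True by (simp add: monom_act_def mps_coeff_total_gen)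
  ultimately have "ipoly_act (ln_basis w) (monom_act ipoly_var w' {#v#}) =
      of_int (comp_coeff w w') * ipoly_var v ^ (1 + weight w' + weight w)"
    using True by (simp only: comp_coeff_def if_True mps_coeff_total_gen_power[of "ipoly_var v"])
  thus ?thesis by (simp only: ac_simps)
next
  case False
  \<comment> \<open>The empty sum in \<open>ipoly_act_basis_sum\<close> gives
    \<open>ipoly_act (ln_basis w) 0 = 0\<close>.\<close>
  thus ?thesis
    using ipoly_act_basis_sum[of w "\<lambda>_. 0" "{}"] by (simp add: monom_act_single comp_coeff_def)
qed

text \<open>
  A series whose coefficients are series serves as a generating function in two independent
  systems of variables.
\<close>

definition coeff2 :: "('v, ('w, 'a) mps) mps \<Rightarrow> 'w multiset \<Rightarrow> 'v multiset \<Rightarrow> 'a" where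
  "coeff2 F w w' = mps_coeff (mps_coeff F w') w"

lemma coeff2_one: "coeff2 1 w w' = (if w = {#} \<and> w' = {#} then 1 else 0)"
  by (simp add: coeff2_def mps_coeff_one)

lemma coeff2_mult:
  "coeff2 (F * G) w w' = (\<Sum>z'\<in>splittings w'. \<Sum>z\<in>splittings w.
     coeff2 F (fst z) (fst z') * coeff2 G (snd z) (snd z'))"
  by (simp add: coeff2_def mps_coeff_mult mps_coeff_sum case_prod_beta)

text \<open>
  Composing the substitutions \<open>y \<mapsto> y + t\<^sub>1 y\<^sup>2 + \<dots>\<close> and \<open>y \<mapsto> y + t\<^sub>1' y\<^sup>2 + \<dots>\<close> gives another one, whose
  coefficient at \<open>y ^ (k + 1)\<close> is \<open>comp_gen k\<close>.
\<close>

definition comp_gen :: "pnat \<Rightarrow> (pnat, (pnat, int) mps) mps" where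
  "comp_gen k = Abs_mps (\<lambda>w'. Abs_mps (\<lambda>w.
     if weight w + weight w' = Rep_pnat k then comp_coeff w w' else 0))"

text \<open>The coefficient of \<open>ln_basis u\<close> in the product of \<open>ln_basis w\<close>
  and \<open>ln_basis w'\<close>. Dually, \<open>comp_gen k\<close> is the coproduct of
  \<open>dual_gen k\<close>; being multiplicative, the coproduct sends the monomial of
  \<open>u\<close> to the product over \<open>u\<close>.\<close>

definition struct_const :: "collection \<Rightarrow> collection \<Rightarrow> collection \<Rightarrow> int" where
  "struct_const u w w' = coeff2 (\<Prod>k\<in>#u. comp_gen k) w w'"

lemma struct_const_empty: "struct_const {#} w w' = (if w = {#} \<and> w' = {#} then 1 else 0)"
  by (simp add: struct_const_def coeff2_one)

lemma struct_const_single: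
  "struct_const {#k#} w w' = (if weight w + weight w' = Rep_pnat k then comp_coeff w w' else 0)"
  by (simp add: struct_const_def comp_gen_def coeff2_def)

lemma struct_const_add:
  "struct_const (u + u') w w' = (\<Sum>z'\<in>splittings w'. \<Sum>z\<in>splittings w.
     struct_const u (fst z) (fst z') * struct_const u' (snd z) (snd z'))"
  by (simp add: struct_const_def coeff2_mult)

text \<open>The product is graded: \<open>comp_gen k\<close> lives in total weight
  \<open>Rep_pnat k\<close>, and weights add under multiplication.\<close>

lemma struct_const_eq_0:
  "weight u \<noteq> weight w + weight w' \<Longrightarrow> struct_const u w w' = 0"
proof (induction u arbitrary: w w')
  case empty
  thus ?case by (auto simp: struct_const_empty)
next
  case (add k u)
  have "struct_const {#k#} (fst z) (fst z') * struct_const u (snd z) (snd z') = 0"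
    if "z \<in> splittings w" "z' \<in> splittings w'" for z z'
  proof (cases "weight (fst z) + weight (fst z') = Rep_pnat k")
    case True
    with that add.prems have "weight u \<noteq> weight (snd z) + weight (snd z')"
      by (auto simp: splittings_def)
    thus ?thesis by (simp add: add.IH)
  qed (simp add: struct_const_single)
  thus ?case
    using struct_const_add[of "{#k#}" u w w'] by (simp del: mult_eq_0_iff)
qed

text \<open>The value expected for \<open>ln_basis w\<close> applied after
  \<open>ln_basis w'\<close> to the monomial \<open>n\<close>. The cutoff keeps the sum finite;
  beyond it the structure constants vanish.\<close>

definition comp_act :: "collection \<Rightarrow> collection \<Rightarrow> nat multiset \<Rightarrow> ipoly" where
  "comp_act w w' n = (\<Sum>u | weight u \<le> weight w + weight w'.
     of_int (struct_const u w w') * monom_act ipoly_var u n)"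

lemma comp_act_superset:
  assumes "finite A" "{u. weight u \<le> weight w + weight w'} \<subseteq> A"
  shows "comp_act w w' n = (\<Sum>u\<in>A. of_int (struct_const u w w') * monom_act ipoly_var u n)"
  unfolding comp_act_def
proof (rule sum.mono_neutral_left[OF assms], rule ballI)
  fix u assume "u \<in> A - {u. weight u \<le> weight w + weight w'}"
  hence "struct_const u w w' = 0" by (intro struct_const_eq_0) auto
  thus "of_int (struct_const u w w') * monom_act ipoly_var u n = 0" by simp
qed

lemma comp_act_empty: "comp_act w w' {#} = (if w = {#} \<and> w' = {#} then 1 else 0)"
proof -
  have "comp_act w w' {#} = (\<Sum>u | weight u \<le> weight w + weight w'.
      if u = {#} then of_int (struct_const {#} w w') else 0)"
    unfolding comp_act_def by (rule sum.cong) (auto simp: monom_act_empty)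
  also have "\<dots> = of_int (struct_const {#} w w')"
    by (subst sum.delta) simp_all
  finally show ?thesis by (simp add: struct_const_empty)
qed

text \<open>Collections of two or more entries kill a variable, and the weight leaves a single
  collection with at most one entry.\<close>

lemma comp_act_var:
  "comp_act w w' {#v#} = of_int (comp_coeff w w') * ipoly_var v ^ (1 + weight w + weight w')"
\<comment> \<open>A one-entry collection has positive weight, so in total weight 0 only the empty
  collection contributes.\<close>
proof (cases "weight w + weight w' = 0")
  case True
  hence w: "w = {#}" "w' = {#}" by (simp_all only: add_eq_0_iff_both_eq_0 weight_eq_0_iff)
  have "comp_coeff {#} {#} = 1"
    by (simp add: comp_coeff_def mps_coeff_total_gen)
  moreover have "{u. weight u \<le> weight {#} + weight {#}} = {{#}}"
    by simp
  ultimately show ?thesis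
    unfolding w comp_act_def by (simp add: struct_const_empty monom_act_single)
next
  case False
  define k where "k = Abs_pnat (weight w + weight w')"
  have k: "Rep_pnat k = weight w + weight w'"
    unfolding k_def using False by (intro Abs_pnat_inverse) (simp only: mem_Collect_eq neq0_conv)
  have zero: "of_int (struct_const u w w') * monom_act ipoly_var u {#v#} = 0" if "u \<noteq> {#k#}" for u
  proof (cases "size u \<le> 1")
    case True
    thus ?thesis
    proof (cases rule: size_le_1_cases)
      case 1
      have "\<not> (w = {#} \<and> w' = {#})" using \<open>weight w + weight w' \<noteq> 0\<close> by auto
      thus ?thesis using 1 by (simp only: struct_const_empty if_False of_int_0 mult_zero_left)
    next
      case (2 j)
      hence "weight w + weight w' \<noteq> Rep_pnat j"
        using that k by (metis Rep_pnat_inject)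
      thus ?thesis using 2 by (simp add: struct_const_single)
    qed
  qed (simp add: monom_act_single)
  have "comp_act w w' {#v#} = (\<Sum>u\<in>{{#k#}}. of_int (struct_const u w w') * monom_act ipoly_var u {#v#})"
    unfolding comp_act_def
  proof (rule sum.mono_neutral_right)
    show "\<forall>u\<in>{u. weight u \<le> weight w + weight w'} - {{#k#}}.
        of_int (struct_const u w w') * monom_act ipoly_var u {#v#} = 0"
      using zero by blast
  qed (simp_all add: k)
  also have "\<dots> = of_int (struct_const {#k#} w w') * ipoly_var v ^ (Rep_pnat k + 1)"
    by (simp add: monom_act_single)
  finally show ?thesis
    unfolding struct_const_single k by (simp only: if_True refl ac_simps)
qed

text \<open>Two multiplicativities combine: that of \<open>monom_act\<close> in the monomial, by
  splitting \<open>u\<close>, and that of \<open>struct_const\<close> in \<open>u\<close>, by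
  splitting \<open>w\<close> and \<open>w'\<close>.\<close>

lemma comp_act_Cartan:
  "comp_act w w' (n + n') = (\<Sum>z'\<in>splittings w'. \<Sum>z\<in>splittings w.
     comp_act (fst z) (fst z') n * comp_act (snd z) (snd z') n')"
proof -
  define D where "D = weight w + weight w'"
  define U where "U = {u. weight u \<le> D}"
  have fin: "finite U" by (simp add: U_def)
  let ?M = "monom_act ipoly_var"
  let ?T = "\<lambda>z z'. \<Sum>u\<in>U. \<Sum>u'\<in>U.
    of_int (struct_const u (fst z) (fst z') * struct_const u' (snd z) (snd z')) * (?M u n * ?M u' n')"
  have split: "comp_act (fst z) (fst z') n * comp_act (snd z) (snd z') n' = ?T z z'"
    if "z \<in> splittings w" "z' \<in> splittings w'" for z z'
  proof -
    have "comp_act (fst z) (fst z') n = (\<Sum>u\<in>U. of_int (struct_const u (fst z) (fst z')) * ?M u n)"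
         "comp_act (snd z) (snd z') n' = (\<Sum>u\<in>U. of_int (struct_const u (snd z) (snd z')) * ?M u n')"
      using that by (intro comp_act_superset fin; auto simp: U_def D_def splittings_def)+
    thus ?thesis
      by (simp only: sum_product of_int_mult) (intro sum.cong refl, simp only: mult_ac)
  qed
  \<comment> \<open>A collection together with a splitting of it is regrouped as the pair of its two
    parts.\<close>
  have "comp_act w w' (n + n') = (\<Sum>u\<in>U. \<Sum>z\<in>splittings u.
      of_int (struct_const (fst z + snd z) w w') * (?M (fst z) n * ?M (snd z) n'))"
    unfolding comp_act_def U_def D_def
    by (intro sum.cong refl)
       (auto simp: monom_act_Cartan sum_distrib_left splittings_def intro!: sum.cong)
  also have "\<dots> = (\<Sum>(v, z)\<in>Sigma U splittings.
      of_int (struct_const (fst z + snd z) w w') * (?M (fst z) n * ?M (snd z) n'))"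
    by (simp add: sum.Sigma fin)
  also have "\<dots> = (\<Sum>z\<in>{z. fst z + snd z \<in> U}.
      of_int (struct_const (fst z + snd z) w w') * (?M (fst z) n * ?M (snd z) n'))"
    by (rule sum.reindex_bij_witness[where j = snd and i = "\<lambda>z. (fst z + snd z, z)"])
       (auto simp: splittings_def)
  \<comment> \<open>Pairs of total weight above \<open>D\<close> may join the sum because their
    structure constants vanish.\<close>
  also have "\<dots> = (\<Sum>z\<in>U \<times> U.
      of_int (struct_const (fst z + snd z) w w') * (?M (fst z) n * ?M (snd z) n'))"
  proof (rule sum.mono_neutral_left)
    show "finite (U \<times> U)" using fin by blast
    show "{z. fst z + snd z \<in> U} \<subseteq> U \<times> U" by (auto simp: U_def)
    show "\<forall>z\<in>U \<times> U - {z. fst z + snd z \<in> U}.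
        of_int (struct_const (fst z + snd z) w w') * (?M (fst z) n * ?M (snd z) n') = 0"
    proof
      fix z assume "z \<in> U \<times> U - {z. fst z + snd z \<in> U}"
      hence "weight (fst z + snd z) \<noteq> weight w + weight w'" by (auto simp: U_def D_def)
      hence "struct_const (fst z + snd z) w w' = 0" by (rule struct_const_eq_0)
      thus "of_int (struct_const (fst z + snd z) w w') * (?M (fst z) n * ?M (snd z) n') = 0"
        by (simp only: of_int_0 mult_zero_left)
    qed
  qed
  also have "\<dots> = (\<Sum>z\<in>U \<times> U. \<Sum>y'\<in>splittings w'. \<Sum>y\<in>splittings w.
      of_int (struct_const (fst z) (fst y) (fst y') * struct_const (snd z) (snd y) (snd y')) *
      (?M (fst z) n * ?M (snd z) n'))"
    by (simp only: struct_const_add of_int_sum sum_distrib_right)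
  also have "\<dots> = (\<Sum>y'\<in>splittings w'. \<Sum>y\<in>splittings w. \<Sum>z\<in>U \<times> U.
      of_int (struct_const (fst z) (fst y) (fst y') * struct_const (snd z) (snd y) (snd y')) *
      (?M (fst z) n * ?M (snd z) n'))"
    by (subst sum.swap, rule sum.cong[OF refl], rule sum.swap)
  also have "\<dots> = (\<Sum>y'\<in>splittings w'. \<Sum>y\<in>splittings w. ?T y y')"
    by (simp only: sum.cartesian_product[of _ U U] case_prod_unfold)
  also have "\<dots> = (\<Sum>y'\<in>splittings w'. \<Sum>y\<in>splittings w.
     comp_act (fst y) (fst y') n * comp_act (snd y) (snd y') n')"
    by (intro sum.cong refl) (rule split[symmetric])
  finally show ?thesis .
qed

text \<open>Both sides obey the same Cartan formula in \<open>n\<close> and agree on single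
  variables.\<close>

lemma ipoly_act_monom_act:
  "ipoly_act (ln_basis w) (monom_act ipoly_var w' n) = comp_act w w' n"
proof (induction n arbitrary: w w')
  case empty
  have "ipoly_act (ln_basis w) (monom_act ipoly_var w' {#}) = monom_act ipoly_var w {#}" if "w' = {#}"
    using that ipoly_act_basis_single[of w "{#}" 1] by (simp add: monom_act_empty)
  moreover have "ipoly_act (ln_basis w) (monom_act ipoly_var w' {#}) = 0" if "w' \<noteq> {#}"
    using that ipoly_act_basis_sum[of w "\<lambda>_. 0" "{}"] by (simp add: monom_act_empty)
  ultimately show ?case by (auto simp: comp_act_empty monom_act_empty)
next
  case (add v n)
  have "ipoly_act (ln_basis w) (monom_act ipoly_var w' ({#v#} + n)) =
      (\<Sum>z'\<in>splittings w'. \<Sum>z\<in>splittings w.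
        ipoly_act (ln_basis (fst z)) (monom_act ipoly_var (fst z') {#v#}) *
        ipoly_act (ln_basis (snd z)) (monom_act ipoly_var (snd z') n))"
    by (simp only: monom_act_Cartan ipoly_act_basis_sum ipoly_act_Cartan case_prod_unfold)
  also have "\<dots> = comp_act w w' ({#v#} + n)"
    by (simp only: comp_act_Cartan ipoly_act_monom_act_var comp_act_var add.IH)
  finally show ?case by simp
qed

section \<open>From monomials to all polynomials\<close>

lemma ipoly_act_eq_sum_superset:
  assumes "finite A" "Poly_Mapping.keys s \<subseteq> A"
  shows "ipoly_act s p = (\<Sum>w\<in>A. of_int (Poly_Mapping.lookup s w) * ipoly_act (ln_basis w) p)"
proof -
  have "ipoly_act s p = (\<Sum>w\<in>Poly_Mapping.keys s.
      of_int (Poly_Mapping.lookup s w) * ipoly_act (ln_basis w) p)"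
    unfolding ipoly_act_basis unfolding ipoly_act_def by (simp add: sum_distrib_left mult_ac)
  also have "\<dots> = (\<Sum>w\<in>A. of_int (Poly_Mapping.lookup s w) * ipoly_act (ln_basis w) p)"
    by (rule sum.mono_neutral_left) (use assms in \<open>auto simp: in_keys_iff\<close>)
  finally show ?thesis .
qed

lemmas ipoly_act_eq_sum = ipoly_act_eq_sum_superset[OF finite_keys order_refl]

lemma ipoly_act_basis_comp:
  "ipoly_act (ln_basis w) (ipoly_act (ln_basis w') p) =
     (\<Sum>u | weight u \<le> weight w + weight w'. of_int (struct_const u w w') * ipoly_act (ln_basis u) p)"
proof -
  let ?U = "{u. weight u \<le> weight w + weight w'}" and ?P = "Poly_Mapping.keys p"
  have "ipoly_act (ln_basis w) (ipoly_act (ln_basis w') p) =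
      (\<Sum>n\<in>?P. of_int (Poly_Mapping.lookup p n) * comp_act w w' n)"
    by (simp add: ipoly_act_basis[of w' p] ipoly_act_basis_sum ipoly_act_basis_of_int_mult
        ipoly_act_monom_act)
  also have "\<dots> = (\<Sum>n\<in>?P. \<Sum>u\<in>?U. of_int (struct_const u w w') *
      (of_int (Poly_Mapping.lookup p n) * monom_act ipoly_var u n))"
    by (simp add: comp_act_def sum_distrib_left mult_ac)
  also have "\<dots> = (\<Sum>u\<in>?U. of_int (struct_const u w w') * ipoly_act (ln_basis u) p)"
    by (subst sum.swap) (simp add: ipoly_act_basis sum_distrib_left)
  finally show ?thesis .
qed

section \<open>Faithfulness and the product\<close>

lemma lookup_monomial_mult:
  fixes q :: "'v multiset \<Rightarrow>\<^sub>0 int"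
  shows "Poly_Mapping.lookup (Poly_Mapping.single x 1 * q) m =
    (if x \<subseteq># m then Poly_Mapping.lookup q (m - x) else 0)"
proof -
  have "Poly_Mapping.lookup (Poly_Mapping.single x 1 * q) m =
      (\<Sum>z\<in>splittings m. if z = (x, m - x) then Poly_Mapping.lookup q (m - x) else 0)"
    unfolding lookup_mult_multiset
    by (intro sum.cong refl) (auto simp: splittings_def lookup_single when_def split: if_splits)
  also have "\<dots> = (if (x, m - x) \<in> splittings m then Poly_Mapping.lookup q (m - x) else 0)"
    by (simp add: sum.delta')
  also have "(x, m - x) \<in> splittings m \<longleftrightarrow> x \<subseteq># m"
    by (auto simp: splittings_def subset_mset.add_diff_inverse) (metis mset_subset_eq_add_left)
  finally show ?thesis .
qed

text \<open>A single variable is sent to a power of itself or to 0, and the Cartan formula only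
  multiplies such values.\<close>

lemma keys_monom_act:
  "m \<in> Poly_Mapping.keys (monom_act ipoly_var w n) \<Longrightarrow> set_mset m \<subseteq> set_mset n"
proof (induction n arbitrary: w m)
  case empty
  thus ?case by (auto simp: monom_act_empty split: if_splits)
next
  case (add v n)
  have *: "set_mset a \<subseteq> {v}" if "a \<in> Poly_Mapping.keys (monom_act ipoly_var w' {#v#})" for a w'
  proof (cases "size w' \<le> 1")
    case True
    hence "monom_act ipoly_var w' {#v#} = Poly_Mapping.single (replicate_mset (1 + weight w') v) 1"
      using prod_ipoly_var[of "replicate_mset (1 + weight w') v"]
      by (simp add: monom_act_def mps_coeff_total_gen)
    with that show ?thesis by (auto split: if_splits)
  next
    case False
    with that show ?thesis by (simp add: monom_act_single)
  qed
  have "m \<in> Poly_Mapping.keys (\<Sum>z\<in>splittings w.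
      monom_act ipoly_var (fst z) {#v#} * monom_act ipoly_var (snd z) n)"
    using add.prems monom_act_Cartan[of ipoly_var w "{#v#}" n] by (simp add: case_prod_unfold)
  from subsetD[OF keys_sum this] obtain z where
      "m \<in> Poly_Mapping.keys (monom_act ipoly_var (fst z) {#v#} * monom_act ipoly_var (snd z) n)"
    by blast
  from subsetD[OF keys_mult this] obtain a b
    where "m = a + b" "a \<in> Poly_Mapping.keys (monom_act ipoly_var (fst z) {#v#})"
      "b \<in> Poly_Mapping.keys (monom_act ipoly_var (snd z) n)"
    by blast
  with *[of a] add.IH[of b] show ?case by auto
qed

lemma eq_if_size_le_1_if_weight_eq:
  assumes "size w \<le> 1" "size w' \<le> 1" "weight w = weight w'"
  shows "w = w'"
  using assms by (elim size_le_1_cases) (simp_all add: Rep_pnat_inject)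

text \<open>
  The collection \<open>w\<close> is recovered from one coefficient of \<open>s\<^sub>w\<close> on a product of distinct variables.
\<close>

lemma lookup_monom_act_distinct:
  assumes "finite J" "\<And>j. size (c j) \<le> 1"
  shows "Poly_Mapping.lookup (monom_act ipoly_var w (mset_set J))
      (\<Sum>j\<in>J. replicate_mset (1 + weight (c j)) j) = (if w = (\<Sum>j\<in>J. c j) then 1 else 0)"
  using assms(1)
proof (induction J arbitrary: w rule: finite_induct)
  case empty
  show ?case by (simp add: monom_act_empty)
next
  case (insert j J)
  define e where "e = (\<Sum>i\<in>J. replicate_mset (1 + weight (c i)) i)"
  define C where "C = (\<Sum>i\<in>J. c i)"
  have j_e: "count e j = 0"
    unfolding e_def using insert.hyps by (auto simp: count_sum)
  let ?M = "\<lambda>w. monom_act ipoly_var w (mset_set J)"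
  have zero: "Poly_Mapping.lookup (?M w'') m = 0" if "j \<in># m" for w'' m
    using keys_monom_act[of m w'' "mset_set J"] that insert.hyps by (auto simp: in_keys_iff)
  have *: "Poly_Mapping.lookup (monom_act ipoly_var w' {#j#} * ?M w'') (replicate_mset (1 + weight (c j)) j + e)
      = (if (w', w'') = (c j, C) then 1 else 0)" for w' w''
  proof (cases "size w' \<le> 1")
    case True
    have "monom_act ipoly_var w' {#j#} = Poly_Mapping.single (replicate_mset (1 + weight w') j) 1"
      using True prod_ipoly_var[of "replicate_mset (1 + weight w') j"]
      by (simp add: monom_act_def mps_coeff_total_gen)
    note M = lookup_monomial_mult[of "replicate_mset (1 + weight w') j" "?M w''"
        "replicate_mset (1 + weight (c j)) j + e", folded this]
    \<comment> \<open>Compare exponents of \<open>j\<close>. If \<open>w'\<close> is too light, the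
      other factor would have to contain \<open>j\<close>, which is not in \<open>J\<close>; if it
      is too heavy, its power of \<open>j\<close> does not divide the monomial.\<close>
    consider "weight w' = weight (c j)" | "weight w' < weight (c j)" | "weight (c j) < weight w'"
      by linarith
    thus ?thesis
    proof cases
      case 1
      hence w': "w' = c j" using True assms(2) by (intro eq_if_size_le_1_if_weight_eq) auto
      have "Poly_Mapping.lookup (monom_act ipoly_var w' {#j#} * ?M w'')
          (replicate_mset (1 + weight (c j)) j + e) = Poly_Mapping.lookup (?M w'') e"
        unfolding M 1 by simp
      also have "\<dots> = (if w'' = C then 1 else 0)"
        unfolding e_def C_def by (rule insert.IH)
      finally show ?thesis by (simp only: w' prod.inject simp_thms)
    next
      case 2
      hence "j \<in># replicate_mset (1 + weight (c j)) j + e - replicate_mset (1 + weight w') j"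
        by (simp add: count_greater_zero_iff[symmetric] del: count_greater_zero_iff)
      from zero[OF this] 2 show ?thesis unfolding M by auto
    next
      case 3
      have "\<not> replicate_mset (1 + weight w') j \<subseteq># replicate_mset (1 + weight (c j)) j + e"
      proof
        assume "replicate_mset (1 + weight w') j \<subseteq># replicate_mset (1 + weight (c j)) j + e"
        from mset_subset_eq_count[OF this, of j] show False using 3 j_e by simp
      qed
      thus ?thesis unfolding M using 3 by auto
    qed
  next
    case False
    moreover have "w' \<noteq> c j" using False assms(2) by auto
    ultimately show ?thesis by (simp add: monom_act_single)
  qed
  have J: "mset_set (insert j J) = {#j#} + mset_set J"
    "(\<Sum>i\<in>insert j J. replicate_mset (1 + weight (c i)) i) = replicate_mset (1 + weight (c j)) j + e"
    using insert.hyps by (simp_all add: e_def)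
  have "Poly_Mapping.lookup (monom_act ipoly_var w (mset_set (insert j J)))
        (\<Sum>i\<in>insert j J. replicate_mset (1 + weight (c i)) i) =
      (\<Sum>(w', w'')\<in>splittings w. Poly_Mapping.lookup
        (monom_act ipoly_var w' {#j#} * ?M w'') (replicate_mset (1 + weight (c j)) j + e))"
    unfolding J monom_act_Cartan lookup_sum case_prod_unfold ..
  also have "\<dots> = (\<Sum>z\<in>splittings w. if z = (c j, C) then 1 else 0)"
    unfolding * by (intro sum.cong) (auto split: if_splits)
  also have "\<dots> = (if (c j, C) \<in> splittings w then 1 else 0)"
    by (rule sum.delta) simp
  finally show ?case using insert.hyps by (auto simp: splittings_def C_def)
qed

text \<open>Places one entry of \<open>w\<close> on each of finitely many variables, the form
  required by \<open>lookup_monom_act_distinct\<close>.\<close>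

lemma collection_as_sum:
  "\<exists>(N::nat) c. (\<forall>j. size (c j) \<le> 1) \<and> (w :: collection) = (\<Sum>j\<in>{1..N}. c j)"
proof (induction w)
  case empty
  show ?case by (rule exI[of _ 0], rule exI[of _ "\<lambda>_. {#}"]) simp
next
  case (add k w)
  then obtain N :: nat and c where c: "\<forall>j. size (c j) \<le> 1" "w = (\<Sum>j\<in>{1..N}. c j)" by blast
  have "(\<Sum>j\<in>{1..N}. (c(Suc N := {#k#})) j) = w"
    unfolding c(2) by (intro sum.cong) auto
  hence "(\<Sum>j\<in>{1..Suc N}. (c(Suc N := {#k#})) j) = add_mset k w"
    by simp
  thus ?case using c(1) by (intro exI[of _ "Suc N"], intro exI[of _ "c(Suc N := {#k#})"]) simp
qed

text \<open>\<open>N\<close> and \<open>m\<close> depend on \<open>w\<close> but not on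
  \<open>s\<close>, so one coefficient can be compared for two elements of the algebra.\<close>

lemma lookup_ipoly_act_monomial:
  obtains N m where "\<And>s. Poly_Mapping.lookup
    (ipoly_act s (Poly_Mapping.single (mset_set {1..N}) 1)) m = Poly_Mapping.lookup s w"
proof -
  obtain N :: nat and c where c: "\<And>j. size (c j) \<le> 1" "w = (\<Sum>j\<in>{1..N}. c j)"
    using collection_as_sum by blast
  let ?m = "\<Sum>j\<in>{1..N}. replicate_mset (1 + weight (c j)) j"
  have "Poly_Mapping.lookup (ipoly_act s (Poly_Mapping.single (mset_set {1..N}) 1)) ?m =
      (\<Sum>w'\<in>Poly_Mapping.keys s. if w' = w then Poly_Mapping.lookup s w' else 0)" for s
    unfolding ipoly_act_eq_sum[of s] lookup_sum ipoly_act_basis_single lookup_of_int_mult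
      lookup_monom_act_distinct[OF finite_atLeastAtMost c(1)] c(2)
    by (intro sum.cong) auto
  hence "Poly_Mapping.lookup (ipoly_act s (Poly_Mapping.single (mset_set {1..N}) 1)) ?m =
      Poly_Mapping.lookup s w" for s
    by (simp add: sum.delta in_keys_iff)
  thus ?thesis using that by blast
qed

lemma ipoly_act_faithful:
  assumes "\<And>N p. p \<in> ipoly_ring N \<Longrightarrow> ipoly_act s p = ipoly_act t p"
  shows "s = t"
proof (rule poly_mapping_eqI)
  fix w
  obtain N m where *: "\<And>s. Poly_Mapping.lookup
      (ipoly_act s (Poly_Mapping.single (mset_set {1..N}) 1)) m = Poly_Mapping.lookup s w"
    using lookup_ipoly_act_monomial by blast
  have "Poly_Mapping.single (mset_set {1..N}) 1 \<in> ipoly_ring N"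
    by (simp add: ipoly_ring_def)
  from assms[OF this] show "Poly_Mapping.lookup s w = Poly_Mapping.lookup t w"
    using *[of s] *[of t] by (simp only:)
qed

section \<open>The product in terms of structure constants\<close>

lemma ln_times_eqI:
  assumes "\<And>p. ipoly_act u p = ipoly_act s (ipoly_act t p)"
  shows "ln_times s t = u"
  unfolding ln_times_def
proof (rule the_equality)
  fix v assume "\<forall>N. \<forall>p\<in>ipoly_ring N. ipoly_act v p = ipoly_act s (ipoly_act t p)"
  thus "v = u" using assms by (intro ipoly_act_faithful) auto
qed (simp add: assms)

lemma ln_times_one_left: "ln_times (ln_basis {#}) s = s"
  by (rule ln_times_eqI) (simp add: ipoly_act_one)

text \<open>The right factor is a basis element because \<open>ln_basis w'\<close> acts on the dual
  through multiplication by it on the right.\<close>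

definition ln_product :: "ln \<Rightarrow> collection \<Rightarrow> ln" where
  "ln_product s w' = (\<Sum>w\<in>Poly_Mapping.keys s. \<Sum>u | weight u \<le> weight w + weight w'.
     Poly_Mapping.single u (Poly_Mapping.lookup s w * struct_const u w w'))"

lemma lookup_ln_product:
  "Poly_Mapping.lookup (ln_product s w') u =
     (\<Sum>w\<in>Poly_Mapping.keys s. Poly_Mapping.lookup s w * struct_const u w w')"
proof -
  have "struct_const u w w' = 0" if "\<not> weight u \<le> weight w + weight w'" for w
    using that by (intro struct_const_eq_0) simp
  thus ?thesis
    by (auto simp: ln_product_def lookup_sum lookup_single when_def intro!: sum.cong)
qed

lemma ipoly_act_add_left: "ipoly_act (s + t) p = ipoly_act s p + ipoly_act t p"
proof -
  let ?A = "Poly_Mapping.keys s \<union> Poly_Mapping.keys t"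
  have "Poly_Mapping.keys (s + t) \<subseteq> ?A" by (rule Poly_Mapping.keys_add)
  thus ?thesis
    by (simp add: ipoly_act_eq_sum_superset[of ?A] lookup_add distrib_right sum.distrib)
qed

lemma ipoly_act_sum_left: "ipoly_act (\<Sum>i\<in>I. s i) p = (\<Sum>i\<in>I. ipoly_act (s i) p)"
proof (induction I rule: infinite_finite_induct)
  case (insert i I)
  thus ?case by (simp add: ipoly_act_add_left)
qed (simp_all add: ipoly_act_def)

lemma ipoly_act_single_left:
  "ipoly_act (Poly_Mapping.single w c) p = of_int c * ipoly_act (ln_basis w) p"
  by (subst ipoly_act_eq_sum_superset[of "{w}"]) auto

lemma ln_times_basis: "ln_times s (ln_basis w') = ln_product s w'"
proof (rule ln_times_eqI)
  fix p
  have "ipoly_act s (ipoly_act (ln_basis w') p) = (\<Sum>w\<in>Poly_Mapping.keys s.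
      of_int (Poly_Mapping.lookup s w) * (\<Sum>u | weight u \<le> weight w + weight w'.
        of_int (struct_const u w w') * ipoly_act (ln_basis u) p))"
    by (simp only: ipoly_act_eq_sum[of s] ipoly_act_basis_comp)
  thus "ipoly_act (ln_product s w') p = ipoly_act s (ipoly_act (ln_basis w') p)"
    by (simp add: ln_product_def ipoly_act_sum_left ipoly_act_single_left sum_distrib_left mult.assoc)
qed

section \<open>The action on the dual\<close>

lemma pairing_eq_sum_keys_left:
  "pairing l s = (\<Sum>w\<in>Poly_Mapping.keys l. Poly_Mapping.lookup l w * Poly_Mapping.lookup s w)"
proof -
  let ?A = "Poly_Mapping.keys l \<union> Poly_Mapping.keys s"
  have "pairing l s = (\<Sum>w\<in>?A. Poly_Mapping.lookup l w * Poly_Mapping.lookup s w)"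
    unfolding pairing_def by (rule sum.mono_neutral_left) (auto simp: in_keys_iff)
  also have "\<dots> = (\<Sum>w\<in>Poly_Mapping.keys l. Poly_Mapping.lookup l w * Poly_Mapping.lookup s w)"
    by (rule sum.mono_neutral_right) (auto simp: in_keys_iff)
  finally show ?thesis .
qed

text \<open>Unfolds the definite description in \<open>dual_act\<close>: the transpose of right
  multiplication by \<open>ln_basis w'\<close> exists as an element \<open>m\<close> of the graded
  dual, and the pairing with basis elements makes it unique.\<close>

lemma pairing_dual_act: "pairing (dual_act (ln_basis w') l) s' = pairing l (ln_times s' (ln_basis w'))"
proof -
  let ?c = "\<lambda>w. \<Sum>u\<in>Poly_Mapping.keys l. Poly_Mapping.lookup l u * struct_const u w w'"
  define m where "m = Abs_poly_mapping ?c"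
  \<comment> \<open>Finite support comes from the grading: a nonzero structure constant forces
    \<open>weight w\<close> to be at most \<open>weight u\<close> for one of the finitely many keys
    \<open>u\<close> of \<open>l\<close>.\<close>
  have "{w. ?c w \<noteq> 0} \<subseteq> (\<Union>u\<in>Poly_Mapping.keys l. {w. weight w \<le> weight u})"
  proof
    fix w assume "w \<in> {w. ?c w \<noteq> 0}"
    then obtain u where "u \<in> Poly_Mapping.keys l" "struct_const u w w' \<noteq> 0"
      by (auto elim: sum.not_neutral_contains_not_neutral)
    thus "w \<in> (\<Union>u\<in>Poly_Mapping.keys l. {w. weight w \<le> weight u})"
      using struct_const_eq_0[of u w w'] by force
  qed
  hence "finite {w. ?c w \<noteq> 0}" by (rule finite_subset) simp
  hence m: "Poly_Mapping.lookup m = ?c" by (simp add: m_def)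
  have pair: "pairing m s' = pairing l (ln_times s' (ln_basis w'))" for s'
  proof -
    have "pairing m s' = (\<Sum>w\<in>Poly_Mapping.keys s'. \<Sum>u\<in>Poly_Mapping.keys l.
        Poly_Mapping.lookup l u * (Poly_Mapping.lookup s' w * struct_const u w w'))"
      by (simp add: pairing_def m sum_distrib_left mult_ac)
    also have "\<dots> = pairing l (ln_product s' w')"
      by (subst sum.swap) (simp add: pairing_eq_sum_keys_left lookup_ln_product sum_distrib_left)
    finally show ?thesis by (simp add: ln_times_basis)
  qed
  have "dual_act (ln_basis w') l = m"
    unfolding dual_act_def
  proof (rule the_equality)
    fix m' assume m': "\<forall>s'. pairing m' s' = pairing l (ln_times s' (ln_basis w'))"
    show "m' = m"
      by (rule poly_mapping_eqI) (metis m' pair pairing_basis)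
  qed (simp add: pair)
  thus ?thesis by (simp add: pair)
qed

text \<open>Take \<open>s' = 1\<close> in the defining equation of the action; the coefficient at
  \<open>{#}\<close> is the pairing with 1. Hence the augmented values determine
  \<open>l\<close>.\<close>

lemma lookup_dual_act_empty:
  "Poly_Mapping.lookup (dual_act (ln_basis w) l) {#} = Poly_Mapping.lookup l w"
  by (metis pairing_basis pairing_dual_act ln_times_one_left)

section \<open>Substitution\<close>

lemma mps_coeff_mps_var: "mps_coeff (mps_var v) m = (if m = {#v#} then 1 else 0)"
  by (simp add: mps_var_def)

text \<open>Without a constant term, each factor uses up at least one variable of
  \<open>m\<close>.\<close>

lemma mps_coeff_prod_mset_eq_0:
  assumes "\<And>v. mps_coeff (g v) {#} = 0" "size m < size n"
  shows "mps_coeff (\<Prod>v\<in>#n. g v) m = 0"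
  using assms(2)
proof (induction n arbitrary: m)
  case (add v n)
  have "mps_coeff (g v) (fst z) * mps_coeff (\<Prod>v\<in>#n. g v) (snd z) = 0" if "z \<in> splittings m" for z
  proof (cases "fst z = {#}")
    case False
    hence "size (snd z) < size n"
      using that add.prems by (cases "fst z") (auto simp: splittings_def)
    thus ?thesis by (simp add: add.IH)
  qed (simp add: assms(1))
  thus ?case by (simp add: mps_coeff_mult case_prod_unfold)
qed simp

text \<open>Each \<open>g v\<close> is \<open>v\<close> plus terms of size at least 2, so the lowest
  part of the product is the monomial \<open>n\<close> itself.\<close>

lemma mps_coeff_prod_mset_leading:
  assumes "\<And>v. mps_coeff (g v) {#} = 0"
    and "\<And>u v. mps_coeff (g v) {#u#} = (if u = v then 1 else 0)"
    and "size m \<le> size n"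
  shows "mps_coeff (\<Prod>v\<in>#n. g v) m = (if m = n then 1 else 0)"
  using assms(3)
proof (induction n arbitrary: m)
  case empty
  thus ?case by (simp add: mps_coeff_one)
next
  case (add v n)
  let ?P = "\<Prod>v\<in>#n. g v"
  have "mps_coeff (g v) a * mps_coeff ?P b = (if (a, b) = ({#v#}, n) then 1 else 0)"
    if "(a, b) \<in> splittings m" for a b
  proof -
    \<comment> \<open>A part \<open>a\<close> of size at least 2 leaves too few variables for the
      remaining factors.\<close>
    consider "a = {#}" | u where "a = {#u#}" | "1 < size a"
      using size_1_singleton_mset[of a] by (cases "size a = 0"; cases "size a = 1") auto
    thus ?thesis
    proof cases
      case 1
      thus ?thesis by (simp add: assms(1))
    next
      case (2 u)
      hence "size b \<le> size n" using that add.prems by (auto simp: splittings_def)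
      thus ?thesis using 2 by (simp add: assms(2) add.IH)
    next
      case 3
      hence "size b < size n" using that add.prems by (auto simp: splittings_def)
      from mps_coeff_prod_mset_eq_0[OF assms(1) this] show ?thesis using 3 by auto
    qed
  qed
  hence "mps_coeff (g v * ?P) m = (\<Sum>z\<in>splittings m. if z = ({#v#}, n) then 1 else 0)"
    unfolding mps_coeff_mult by (intro sum.cong) (auto split: if_splits)
  also have "\<dots> = (if ({#v#}, n) \<in> splittings m then 1 else 0)"
    by (rule sum.delta) simp
  finally show ?case by (auto simp: splittings_def)
qed

lemma mps_coeff_subst:
  "mps_coeff (mps_subst F g) m =
     (\<Sum>n | size n \<le> size m. mps_coeff F n * mps_coeff (\<Prod>v\<in>#n. g v) m)"
  by (simp add: mps_subst_def)

text \<open>A common cutoff \<open>d\<close> lets coefficients at different monomials be summed over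
  the same range.\<close>

lemma mps_coeff_subst_bound:
  assumes "\<And>v. mps_coeff (g v) {#} = 0" "size m \<le> d"
  shows "mps_coeff (mps_subst F g) m =
     (\<Sum>n | size n \<le> d. mps_coeff F n * mps_coeff (\<Prod>v\<in>#n. g v) m)"
  unfolding mps_coeff_subst
proof (rule sum.mono_neutral_left)
  show "finite {n :: 'a multiset. size n \<le> d}" by (rule finite_multisets_of_bounded_size)
  show "\<forall>n\<in>{n. size n \<le> d} - {n. size n \<le> size m}.
      mps_coeff F n * mps_coeff (\<Prod>v\<in>#n. g v) m = 0"
    using mps_coeff_prod_mset_eq_0[of g m, OF assms(1)] by auto
qed (use assms(2) in auto)

lemma mps_coeff_subst_empty: "mps_coeff (mps_subst F g) {#} = mps_coeff F {#}"
  by (simp add: mps_coeff_subst mps_coeff_one)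

lemma mps_subst_add: "mps_subst (F + G) g = mps_subst F g + mps_subst G g"
  by (rule mps_eqI) (simp add: mps_coeff_subst distrib_right sum.distrib)

lemma mps_subst_zero: "mps_subst 0 g = 0"
  by (rule mps_eqI) (simp add: mps_coeff_subst)

lemma mps_subst_one:
  fixes g :: "'v::finite \<Rightarrow> ('w, 'a::comm_ring_1) mps"
  shows "mps_subst 1 g = 1"
proof (rule mps_eqI)
  fix m
  have "mps_coeff (mps_subst 1 g) m =
      (\<Sum>n | size n \<le> size m. if n = ({#} :: 'v multiset) then mps_coeff 1 m else 0)"
    unfolding mps_coeff_subst by (intro sum.cong) (auto simp: mps_coeff_one)
  also have "\<dots> = mps_coeff 1 m"
    by (subst sum.delta) (simp_all add: finite_multisets_of_bounded_size)
  finally show "mps_coeff (mps_subst 1 g) m = mps_coeff 1 m" .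
qed

lemma mps_subst_var:
  assumes "\<And>v. mps_coeff (g v) {#} = 0"
  shows "mps_subst (mps_var v) g = g v"
proof (rule mps_eqI)
  fix m
  \<comment> \<open>The cutoff is \<open>Suc (size m)\<close> so that \<open>{#v#}\<close> is in
    range even when \<open>m\<close> is empty.\<close>
  have "mps_coeff (mps_subst (mps_var v) g) m =
      (\<Sum>n | size n \<le> Suc (size m). if n = {#v#} then mps_coeff (g v) m else 0)"
    unfolding mps_coeff_subst_bound[of g m "Suc (size m)", OF assms le_SucI[OF order_refl]]
    by (intro sum.cong) (auto simp: mps_coeff_mps_var)
  also have "\<dots> = mps_coeff (g v) m"
    by (subst sum.delta) (simp_all add: finite_multisets_of_bounded_size)
  finally show "mps_coeff (mps_subst (mps_var v) g) m = mps_coeff (g v) m" .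
qed

lemma mps_subst_mult:
  fixes g :: "'v::finite \<Rightarrow> ('w, 'a::comm_ring_1) mps"
  assumes "\<And>v. mps_coeff (g v) {#} = 0"
  shows "mps_subst (F * G) g = mps_subst F g * mps_subst G g"
proof (rule mps_eqI)
  fix m :: "'w multiset"
  define U where "U = {n :: 'v multiset. size n \<le> size m}"
  have fin: "finite U" unfolding U_def by (rule finite_multisets_of_bounded_size)
  let ?P = "\<lambda>n. \<Prod>v\<in>#n. g v"
  let ?t = "\<lambda>n n'. mps_coeff F n * mps_coeff G n'"
  have "mps_coeff (mps_subst (F * G) g) m =
      (\<Sum>n\<in>U. \<Sum>z\<in>splittings n. ?t (fst z) (snd z) * mps_coeff (?P n) m)"
    by (simp add: mps_coeff_subst mps_coeff_mult[of F G] U_def sum_distrib_right case_prod_unfold)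
  also have "\<dots> = (\<Sum>(n, z)\<in>Sigma U splittings. ?t (fst z) (snd z) * mps_coeff (?P n) m)"
    by (simp add: sum.Sigma fin)
  also have "\<dots> = (\<Sum>z\<in>{z. fst z + snd z \<in> U}.
      ?t (fst z) (snd z) * mps_coeff (?P (fst z + snd z)) m)"
    by (rule sum.reindex_bij_witness[where j = snd and i = "\<lambda>z. (fst z + snd z, z)"])
       (auto simp: splittings_def)
  \<comment> \<open>The added pairs contribute products with more than \<open>size m\<close>
    factors, whose coefficient at \<open>m\<close> is 0.\<close>
  also have "\<dots> = (\<Sum>z\<in>U \<times> U. ?t (fst z) (snd z) * mps_coeff (?P (fst z + snd z)) m)"
  proof (rule sum.mono_neutral_left)
    show "finite (U \<times> U)" using fin by blast
    show "{z. fst z + snd z \<in> U} \<subseteq> U \<times> U" by (auto simp: U_def)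
    show "\<forall>z\<in>U \<times> U - {z. fst z + snd z \<in> U}.
        ?t (fst z) (snd z) * mps_coeff (?P (fst z + snd z)) m = 0"
    proof
      fix z assume "z \<in> U \<times> U - {z. fst z + snd z \<in> U}"
      hence "size m < size (fst z + snd z)" by (auto simp: U_def)
      from mps_coeff_prod_mset_eq_0[OF assms this]
      show "?t (fst z) (snd z) * mps_coeff (?P (fst z + snd z)) m = 0" by (simp only: mult_zero_right)
    qed
  qed
  also have "\<dots> = (\<Sum>z\<in>U \<times> U. \<Sum>y\<in>splittings m. ?t (fst z) (snd z) *
      (mps_coeff (?P (fst z)) (fst y) * mps_coeff (?P (snd z)) (snd y)))"
    by (simp only: image_mset_union prod_mset.union mps_coeff_mult case_prod_unfold sum_distrib_left)
  also have "\<dots> = (\<Sum>y\<in>splittings m. \<Sum>z\<in>U \<times> U. ?t (fst z) (snd z) *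
      (mps_coeff (?P (fst z)) (fst y) * mps_coeff (?P (snd z)) (snd y)))"
    by (rule sum.swap)
  also have "\<dots> = (\<Sum>y\<in>splittings m. mps_coeff (mps_subst F g) (fst y) * mps_coeff (mps_subst G g) (snd y))"
  proof (rule sum.cong[OF refl])
    fix y assume "y \<in> splittings m"
    hence le: "size (fst y) \<le> size m" "size (snd y) \<le> size m" by (auto simp: splittings_def)
    show "(\<Sum>z\<in>U \<times> U. ?t (fst z) (snd z) *
        (mps_coeff (?P (fst z)) (fst y) * mps_coeff (?P (snd z)) (snd y))) =
      mps_coeff (mps_subst F g) (fst y) * mps_coeff (mps_subst G g) (snd y)"
      unfolding mps_coeff_subst_bound[of g, OF assms le(1)] mps_coeff_subst_bound[of g, OF assms le(2)]
        U_def[symmetric] sum_product sum.cartesian_product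
      by (intro sum.cong) (auto simp: mult_ac)
  qed
  also have "\<dots> = mps_coeff (mps_subst F g * mps_subst G g) m"
    by (simp add: mps_coeff_mult case_prod_unfold)
  finally show "mps_coeff (mps_subst (F * G) g) m = mps_coeff (mps_subst F g * mps_subst G g) m" .
qed

lemma mps_subst_prod_mset:
  assumes "\<And>v. mps_coeff (g v) {#} = 0"
  shows "mps_subst (\<Prod>i\<in>#n. F i) g = (\<Prod>i\<in>#n. mps_subst (F i) g)"
  by (induction n) (simp_all add: mps_subst_one mps_subst_mult assms)

lemma mps_subst_subst:
  assumes "\<And>v. mps_coeff (g v) {#} = 0" "\<And>v. mps_coeff (h v) {#} = 0"
  shows "mps_subst (mps_subst F g) h = mps_subst F (\<lambda>v. mps_subst (g v) h)"
proof (rule mps_eqI)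
  fix m
  let ?P = "\<lambda>k. \<Prod>v\<in>#k. g v" and ?Q = "\<lambda>n. \<Prod>v\<in>#n. h v"
  have "mps_coeff (mps_subst (mps_subst F g) h) m =
      (\<Sum>n | size n \<le> size m. (\<Sum>k | size k \<le> size m.
        mps_coeff F k * mps_coeff (?P k) n) * mps_coeff (?Q n) m)"
    unfolding mps_coeff_subst[of "mps_subst F g"]
    by (intro sum.cong refl) (simp add: mps_coeff_subst_bound[OF assms(1)])
  also have "\<dots> = (\<Sum>k | size k \<le> size m. \<Sum>n | size n \<le> size m.
      mps_coeff F k * mps_coeff (?P k) n * mps_coeff (?Q n) m)"
    unfolding sum_distrib_right by (rule sum.swap)
  also have "\<dots> = (\<Sum>k | size k \<le> size m. mps_coeff F k * mps_coeff (mps_subst (?P k) h) m)"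
    by (simp add: mps_coeff_subst sum_distrib_left mult.assoc)
  also have "\<dots> = mps_coeff (mps_subst F (\<lambda>v. mps_subst (g v) h)) m"
    by (simp add: mps_coeff_subst[of F] mps_subst_prod_mset assms(2))
  finally show "mps_coeff (mps_subst (mps_subst F g) h) m =
      mps_coeff (mps_subst F (\<lambda>v. mps_subst (g v) h)) m" .
qed

text \<open>The substitution is unitriangular: its coefficient at \<open>m\<close> is that of the
  original series plus terms from strictly smaller sizes, so coefficients are recovered by induction
  on size.\<close>

lemma mps_subst_inject:
  fixes g :: "'v::finite \<Rightarrow> ('v, 'a::comm_ring_1) mps"
  assumes "\<And>v. mps_coeff (g v) {#} = 0"
    and "\<And>u v. mps_coeff (g v) {#u#} = (if u = v then 1 else 0)"
    and eq: "mps_subst F g = mps_subst G g"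
  shows "F = G"
proof (rule mps_eqI)
  fix m
  show "mps_coeff F m = mps_coeff G m"
  proof (induction "size m" arbitrary: m rule: less_induct)
    case less
    let ?P = "\<lambda>n. \<Prod>v\<in>#n. g v"
    let ?low = "\<lambda>H. \<Sum>n | size n < size m. mps_coeff H n * mps_coeff (?P n) m"
    have expand: "mps_coeff (mps_subst H g) m = ?low H + mps_coeff H m" for H
    proof -
      have "{n :: 'v multiset. size n \<le> size m} = {n. size n < size m} \<union> {n. size n = size m}"
        by auto
      moreover have fin: "finite {n :: 'v multiset. size n < size m}" "finite {n :: 'v multiset. size n = size m}"
        using finite_multisets_of_bounded_size[of "size m"] by (auto intro: finite_subset[rotated])
      ultimately have "mps_coeff (mps_subst H g) m =
          ?low H + (\<Sum>n | size n = size m. mps_coeff H n * mps_coeff (?P n) m)"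
        unfolding mps_coeff_subst by (simp only:) (intro sum.union_disjoint fin, auto)
      also have "(\<Sum>n | size n = size m. mps_coeff H n * mps_coeff (?P n) m) =
          (\<Sum>n | size n = size m. if n = m then mps_coeff H m else 0)"
        using mps_coeff_prod_mset_leading[of g m, OF assms(1,2)] by (intro sum.cong) auto
      also have "\<dots> = mps_coeff H m"
        using fin(2) by (subst sum.delta) simp_all
      finally show ?thesis .
    qed
    have "?low F = ?low G"
      using less by (intro sum.cong) auto
    thus ?case using expand[of F] expand[of G] by (simp only: eq add_left_cancel)
  qed
qed

section \<open>The exponential series\<close>

lemma unit_multiset_eq_replicate: "n = replicate_mset (size n) ()"
  by (induction n) simp_all

text \<open>The series \<open>\<phi>\<close> in one variable, whose monomials are given by their
  size. Size \<open>k + 1\<close> carries the generator with index \<open>k\<close>; sizes 0 and 1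
  are separate because \<open>pnat\<close> starts at 1.\<close>

definition dual_series :: "(unit, ln_dual) mps" where
  "dual_series = Abs_mps (\<lambda>n. if n = {#} then 0 else
     if size n = 1 then 1 else dual_gen (Abs_pnat (size n - 1)))"

definition dual_exp :: "('v, ln_dual) mps \<Rightarrow> ('v, ln_dual) mps" where
  "dual_exp g = mps_subst dual_series (\<lambda>_. g)"

lemma lookup_dual_series:
  "Poly_Mapping.lookup (mps_coeff dual_series n) w = (if size w \<le> 1 \<and> size n = 1 + weight w then 1 else 0)"
proof -
  consider "size n = 0" | "size n = 1" | k where "size n = 1 + Rep_pnat k"
  proof -
    have "size n = 1 + Rep_pnat (Abs_pnat (size n - 1))" if "1 < size n"
      using that by (simp add: Abs_pnat_inverse)
    thus thesis using that by (cases "size n = 0"; cases "size n = 1") auto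
  qed
  thus ?thesis
  proof cases
    case 1
    thus ?thesis by (simp add: dual_series_def)
  next
    case 2
    hence "n \<noteq> {#}" by auto
    with 2 show ?thesis by (auto simp: dual_series_def lookup_one when_def)
  next
    case (3 k)
    have "n \<noteq> {#}" "size n \<noteq> 1" using 3 by auto
    hence "mps_coeff dual_series n = dual_gen k"
      using 3 by (simp add: dual_series_def Rep_pnat_inverse)
    moreover have "size w \<le> 1 \<and> weight w = Rep_pnat k \<longleftrightarrow> w = {#k#}"
      using eq_if_size_le_1_if_weight_eq[of w "{#k#}"] by auto
    ultimately show ?thesis
      using 3 by (auto simp: dual_gen_def lookup_single when_def)
  qed
qed

lemma mps_coeff_prod_mset_Ints:
  assumes "\<And>v m. mps_coeff (g v) m \<in> \<int>"
  shows "mps_coeff (\<Prod>v\<in>#n. g v) m \<in> \<int>"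
proof (induction n arbitrary: m)
  case (add v n)
  thus ?case by (auto simp: mps_coeff_mult case_prod_unfold assms intro!: Ints_sum Ints_mult)
qed (simp add: mps_coeff_one)

text \<open>
  Pairing with \<open>s\<^sub>w\<close> turns \<open>dual_exp g\<close> into the value that \<open>s\<^sub>w\<close> would take on \<open>g\<close> if \<open>g\<close> were a
  geometric cobordism element.
\<close>

lemma lookup_dual_exp:
  assumes "mps_coeff g {#} = 0" "\<And>m. mps_coeff g m \<in> \<int>"
  shows "Poly_Mapping.lookup (mps_coeff (dual_exp g) m) w =
    Poly_Mapping.lookup (mps_coeff (mps_coeff (total_gen g) w) m) {#}"
proof (cases "size w \<le> 1")
  case True
  define r where "r = 1 + weight w"
  define N where "N = replicate_mset r ()"
  let ?d = "Poly_Mapping.lookup (mps_coeff (g ^ r) m) {#}"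
  have summand: "Poly_Mapping.lookup (mps_coeff dual_series n * mps_coeff (g ^ size n) m) w =
      (if n = N then ?d else 0)" for n
  proof -
    \<comment> \<open>An integer coefficient passes through the coefficient at \<open>w\<close>, so
      only the exponent \<open>r\<close> selected by \<open>w\<close> in \<open>dual_series\<close>
      survives.\<close>
    have "mps_coeff (g ^ size n) m \<in> \<int>"
      using mps_coeff_prod_mset_Ints[of "\<lambda>_. g" n m] assms(2) by (simp add: prod_mset_constant)
    then obtain z where z: "mps_coeff (g ^ size n) m = of_int z" by (elim Ints_cases)
    have "n = N \<longleftrightarrow> size n = r"
      unfolding N_def by (metis size_replicate_mset unit_multiset_eq_replicate)
    moreover have "?d = z" if "size n = r"
      using z that by (simp add: lookup_of_int)
    moreover have "Poly_Mapping.lookup (mps_coeff dual_series n * mps_coeff (g ^ size n) m) w =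
        (if size n = r then z else 0)"
      using True unfolding z mult.commute[of _ "of_int z"] lookup_of_int_mult lookup_dual_series r_def
      by auto
    ultimately show ?thesis by auto
  qed
  \<comment> \<open>The cutoff \<open>size m + r\<close> puts \<open>N\<close> in range.\<close>
  have "Poly_Mapping.lookup (mps_coeff (dual_exp g) m) w = (\<Sum>n | size n \<le> size m + r. if n = N then ?d else 0)"
    unfolding dual_exp_def mps_coeff_subst_bound[of "\<lambda>_. g" m "size m + r", OF assms(1) le_add1]
      lookup_sum prod_mset_constant summand ..
  also have "\<dots> = ?d"
    by (subst sum.delta) (simp_all add: finite_multisets_of_bounded_size N_def)
  finally show ?thesis using True by (simp add: mps_coeff_total_gen r_def)
next
  case False
  have "Poly_Mapping.lookup (mps_coeff dual_series n * mps_coeff (g ^ size n) m) w = 0" for n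
  proof -
    have "mps_coeff (g ^ size n) m \<in> \<int>"
      using mps_coeff_prod_mset_Ints[of "\<lambda>_. g" n m] assms(2) by (simp add: prod_mset_constant)
    then obtain z where z: "mps_coeff (g ^ size n) m = of_int z" by (elim Ints_cases)
    show ?thesis
      using False unfolding z mult.commute[of _ "of_int z"] lookup_of_int_mult lookup_dual_series
      by auto
  qed
  thus ?thesis
    using False by (simp add: dual_exp_def mps_coeff_subst lookup_sum prod_mset_constant mps_coeff_total_gen)
qed

text \<open>Both sides multiply along splittings of \<open>w\<close>: the left because the product
  of the dual is dual to the coproduct, the right by the Cartan formula. Single variables are
  covered by \<open>lookup_dual_exp\<close>.\<close>

lemma lookup_dual_exp_vars:
  fixes n :: "'v multiset"
  shows "Poly_Mapping.lookup (mps_coeff (\<Prod>v\<in>#n. dual_exp (mps_var v)) m) w =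
    Poly_Mapping.lookup (mps_coeff (monom_act (mps_var :: 'v \<Rightarrow> ('v, ln_dual) mps) w n) m) {#}"
proof (induction n arbitrary: m w)
  case empty
  show ?case by (simp add: mps_coeff_one monom_act_empty lookup_one when_def)
next
  case (add v n)
  let ?x = "mps_var :: 'v \<Rightarrow> ('v, ln_dual) mps"
  let ?P = "\<Prod>v\<in>#n. dual_exp (mps_var v)"
  have var: "Poly_Mapping.lookup (mps_coeff (dual_exp (mps_var v)) m) w =
      Poly_Mapping.lookup (mps_coeff (monom_act ?x w {#v#}) m) {#}" for m w
    by (subst lookup_dual_exp) (simp_all add: mps_coeff_mps_var monom_act_def)
  have "Poly_Mapping.lookup (mps_coeff (dual_exp (mps_var v) * ?P) m) w =
      (\<Sum>y\<in>splittings m. \<Sum>z\<in>splittings w.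
        Poly_Mapping.lookup (mps_coeff (monom_act ?x (fst z) {#v#}) (fst y)) {#} *
        Poly_Mapping.lookup (mps_coeff (monom_act ?x (snd z) n) (snd y)) {#})"
    unfolding mps_coeff_mult lookup_sum case_prod_unfold lookup_mult_multiset var add.IH ..
  also have "\<dots> = (\<Sum>z\<in>splittings w. \<Sum>y\<in>splittings m.
        Poly_Mapping.lookup (mps_coeff (monom_act ?x (fst z) {#v#}) (fst y)) {#} *
        Poly_Mapping.lookup (mps_coeff (monom_act ?x (snd z) n) (snd y)) {#})"
    by (rule sum.swap)
  also have "\<dots> = Poly_Mapping.lookup (mps_coeff (monom_act ?x w ({#v#} + n)) m) {#}"
    unfolding monom_act_Cartan mps_coeff_sum lookup_sum case_prod_unfold mps_coeff_mult
      lookup_mult_multiset by simp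
  finally show ?case by simp
qed

text \<open>On each side \<open>w\<close> is split between coefficient and monomial;
  \<open>lookup_dual_act_empty\<close> matches the coefficients and
  \<open>lookup_dual_exp_vars\<close> the monomials.\<close>

lemma lookup_subst_dual_exp:
  "Poly_Mapping.lookup (mps_coeff (mps_subst F (\<lambda>v. dual_exp (mps_var v))) m) w =
    Poly_Mapping.lookup (mps_coeff (series_act (ln_basis w) F) m) {#}"
proof -
  have "mps_coeff (series_act (ln_basis w) F) m = (\<Sum>n | size n \<le> size m. \<Sum>z\<in>splittings w.
      dual_act (ln_basis (fst z)) (mps_coeff F n) * mps_coeff (monom_act mps_var (snd z) n) m)"
    by (simp add: series_act_def ln_basis_def case_prod_unfold)
  thus ?thesis
    by (simp add: mps_coeff_subst lookup_sum lookup_mult_multiset[where w = w]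
        lookup_mult_multiset[where w = "{#}"] case_prod_unfold lookup_dual_exp_vars
        lookup_dual_act_empty)
qed

section \<open>The exponential equation for a geometric cobordism element\<close>

lemma mps_coeff_prod_mps_var:
  "mps_coeff (\<Prod>v\<in>#n. mps_var v) m = (if m = n then 1 else 0 :: 'a::comm_ring_1)"
proof (induction n arbitrary: m)
  case empty
  show ?case by (simp add: mps_coeff_one)
next
  case (add v n)
  have "mps_coeff (mps_var v * (\<Prod>v\<in>#n. mps_var v)) m =
      (\<Sum>z\<in>splittings m. if z = ({#v#}, n) then 1 else 0 :: 'a)"
    unfolding mps_coeff_mult by (intro sum.cong) (auto simp: mps_coeff_mps_var add.IH split: if_splits)
  also have "\<dots> = (if ({#v#}, n) \<in> splittings m then 1 else 0)"
    by (rule sum.delta) simp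
  finally show ?case by (auto simp: splittings_def)
qed

lemma lookup_series_act_one:
  "Poly_Mapping.lookup (mps_coeff (series_act (ln_basis {#}) F) m) {#} =
    Poly_Mapping.lookup (mps_coeff F m) {#}"
proof -
  have "mps_coeff (series_act (ln_basis {#}) F) m = (\<Sum>n | size n \<le> size m.
      dual_act (ln_basis {#}) (mps_coeff F n) * mps_coeff (monom_act mps_var {#} n) m)"
    by (simp add: series_act_def ln_basis_def)
  also have "\<dots> = (\<Sum>n | size n \<le> size m. if n = m then dual_act (ln_basis {#}) (mps_coeff F m) else 0)"
    by (intro sum.cong) (auto simp: monom_act_empty_collection mps_coeff_prod_mps_var)
  also have "\<dots> = dual_act (ln_basis {#}) (mps_coeff F m)"
    by (subst sum.delta) (simp_all add: finite_multisets_of_bounded_size)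
  finally show ?thesis by (simp add: lookup_dual_act_empty)
qed

text \<open>The two conditions on \<open>F\<close>, together with the unit acting trivially, are the
  three cases in the definition of \<open>total_gen F\<close>.\<close>

lemma geometric_cobordism_subst_dual_exp:
  assumes "geometric_cobordism series_act A2 F"
  shows "Poly_Mapping.lookup (mps_coeff (mps_subst F (\<lambda>v. dual_exp (mps_var v))) m) w =
    Poly_Mapping.lookup (mps_coeff (mps_coeff (total_gen F) w) m) {#}"
proof -
  consider "w = {#}" | k where "w = {#k#}" | "1 < size w"
    using size_le_1_cases[of w] by (metis not_le)
  thus ?thesis
    using assms unfolding lookup_subst_dual_exp geometric_cobordism_def
    by cases (auto simp: lookup_series_act_one mps_coeff_total_gen)
qed

text \<open>The coefficient at \<open>{#}\<close> is a ring homomorphism from the dual to the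
  integers.\<close>

lemma lookup_empty_power_cong:
  fixes F G :: "('v, ln_dual) mps"
  assumes "\<And>m. Poly_Mapping.lookup (mps_coeff F m) {#} = Poly_Mapping.lookup (mps_coeff G m) {#}"
  shows "Poly_Mapping.lookup (mps_coeff (F ^ r) m) {#} = Poly_Mapping.lookup (mps_coeff (G ^ r) m) {#}"
  by (induction r arbitrary: m)
     (simp_all add: mps_coeff_mult lookup_sum case_prod_unfold lookup_mult_multiset assms)

lemma subst_dual_exp_eq:
  assumes f: "f = normalized_series \<alpha>"
    and geo: "geometric_cobordism series_act {F. series_homogeneous 2 F} f"
  shows "mps_subst f (\<lambda>v. dual_exp (mps_var v)) = dual_exp (mps_var 0 + mps_var 1)"
proof (rule mps_eqI, rule poly_mapping_eqI)
  fix m w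
  let ?s = "mps_var 0 + mps_var 1 :: (2, ln_dual) mps"
  \<comment> \<open>The coefficient at \<open>m\<close> has degree \<open>2 - 2 * size m\<close>,
    while the augmentation sees only degree 0. So only \<open>size m = 1\<close> survives, where the
    normalization prescribes the coefficients.\<close>
  have linear: "Poly_Mapping.lookup (mps_coeff f m) {#} = Poly_Mapping.lookup (mps_coeff ?s m) {#}" for m
  proof (cases "size m = 1")
    case True
    then obtain v where "m = {#v#}" using size_1_singleton_mset by blast
    thus ?thesis by (cases "v = 0") (simp_all add: f normalized_series_def)
  next
    case False
    have "dual_homogeneous (2 - 2 * int (size m)) (mps_coeff f m)"
      using geo by (simp add: geometric_cobordism_def series_homogeneous_def)
    with False have "Poly_Mapping.lookup (mps_coeff f m) {#} = 0"
      by (force simp: dual_homogeneous_def in_keys_iff ln_deg_def)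
    with False show ?thesis by (auto simp: mps_coeff_mps_var)
  qed
  have "Poly_Mapping.lookup (mps_coeff (mps_subst f (\<lambda>v. dual_exp (mps_var v))) m) w =
      Poly_Mapping.lookup (mps_coeff (mps_coeff (total_gen f) w) m) {#}"
    using geo by (rule geometric_cobordism_subst_dual_exp)
  also have "\<dots> = Poly_Mapping.lookup (mps_coeff (mps_coeff (total_gen ?s) w) m) {#}"
    unfolding mps_coeff_total_gen using lookup_empty_power_cong[OF linear]
    by (simp del: power_Suc add: plus_1_eq_Suc)
  \<comment> \<open>\<open>lookup_dual_exp\<close> applies because the sum of the two variables has
    integer coefficients.\<close>
  also have "\<dots> = Poly_Mapping.lookup (mps_coeff (dual_exp ?s) m) w"
    by (rule lookup_dual_exp[symmetric]) (auto simp: mps_coeff_mps_var)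
  finally show "Poly_Mapping.lookup (mps_coeff (mps_subst f (\<lambda>v. dual_exp (mps_var v))) m) w =
      Poly_Mapping.lookup (mps_coeff (dual_exp ?s) m) w" .
qed

section \<open>The formal group law\<close>

lemma mps_coeff_dual_exp_empty [simp]: "mps_coeff (dual_exp g) {#} = 0"
  by (simp add: dual_exp_def mps_coeff_subst_empty dual_series_def)

lemma dual_exp_subst:
  assumes "mps_coeff g {#} = 0" "\<And>v. mps_coeff (h v) {#} = 0"
  shows "mps_subst (dual_exp g) h = dual_exp (mps_subst g h)"
  using assms by (simp add: dual_exp_def mps_subst_subst)

lemma dual_exp_zero: "dual_exp 0 = 0"
proof (rule mps_eqI)
  fix m
  have "mps_coeff dual_series n * mps_coeff (0 ^ size n) m = 0" for n
    by (cases "n = {#}") (simp_all add: dual_series_def zero_power nonempty_has_size)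
  thus "mps_coeff (dual_exp 0) m = mps_coeff 0 m"
    by (simp add: dual_exp_def mps_coeff_subst prod_mset_constant)
qed

text \<open>\<open>\<phi>(x)\<close> starts with \<open>x\<close>, so the substitution is
  unitriangular.\<close>

lemma dual_exp_vars_inject:
  fixes F G :: "('v::finite, ln_dual) mps"
  assumes "mps_subst F (\<lambda>v. dual_exp (mps_var v)) = mps_subst G (\<lambda>v. dual_exp (mps_var v))"
  shows "F = G"
proof (rule mps_subst_inject[OF _ _ assms])
  fix u v :: 'v
  show "mps_coeff (dual_exp (mps_var v)) {#u#} = (if u = v then 1 else 0)"
  proof (rule poly_mapping_eqI)
    fix w
    have "mps_coeff (mps_var v ^ Suc r) {#u#} = (if r = 0 \<and> u = v then 1 else 0 :: ln_dual)" for r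
      using mps_coeff_prod_mset_eq_0[of "\<lambda>_. mps_var v" "{#u#}" "replicate_mset (Suc r) v"]
      by (cases "r = 0") (simp_all add: mps_coeff_mps_var)
    hence "Poly_Mapping.lookup (mps_coeff (mps_coeff (total_gen (mps_var v :: ('v, ln_dual) mps)) w) {#u#}) {#} =
        (if w = {#} \<and> u = v then 1 else 0)"
      by (simp add: mps_coeff_total_gen plus_1_eq_Suc mps_coeff_mps_var del: power_Suc)
    thus "Poly_Mapping.lookup (mps_coeff (dual_exp (mps_var v)) {#u#}) w =
        Poly_Mapping.lookup (if u = v then 1 else 0) w"
      by (subst lookup_dual_exp) (auto simp: mps_coeff_mps_var lookup_one when_def)
  qed
qed simp

lemma mps_subst_var_dual_exp:
  "mps_subst (mps_var u) (\<lambda>v. dual_exp (mps_var v)) = dual_exp (mps_var u)"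
  by (rule mps_subst_var) simp

lemma mps_coeff_pair_args_empty:
  "mps_coeff a {#} = 0 \<Longrightarrow> mps_coeff b {#} = 0 \<Longrightarrow> mps_coeff (pair_args a b v) {#} = 0"
  by (simp add: pair_args_def)

lemma subst_pair_args_dual_exp:
  fixes a b :: "('v::finite, ln_dual) mps"
  assumes f: "mps_subst f (\<lambda>v. dual_exp (mps_var v)) = dual_exp (mps_var 0 + mps_var 1)"
    and ab: "mps_coeff a {#} = 0" "mps_coeff b {#} = 0"
  shows "mps_subst f (pair_args (dual_exp a) (dual_exp b)) = dual_exp (a + b)"
proof -
  note zero = mps_coeff_pair_args_empty[OF ab]
  have "(\<lambda>v. mps_subst (dual_exp (mps_var v)) (pair_args a b)) = pair_args (dual_exp a) (dual_exp b)"
    by (rule ext, simp add: dual_exp_subst zero mps_subst_var mps_coeff_mps_var)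
       (simp add: pair_args_def)
  hence "mps_subst f (pair_args (dual_exp a) (dual_exp b)) =
      mps_subst (mps_subst f (\<lambda>v. dual_exp (mps_var v))) (pair_args a b)"
    by (simp add: mps_subst_subst zero)
  also have "\<dots> = dual_exp (pair_args a b 0 + pair_args a b 1)"
    unfolding f by (simp add: dual_exp_subst zero mps_coeff_mps_var mps_subst_add mps_subst_var)
  finally show ?thesis by (simp add: pair_args_def)
qed

text \<open>The conclusion has the same shape as the hypotheses on \<open>a\<close> and
  \<open>b\<close>, so the rule can be nested for iterated uses of \<open>f\<close>.\<close>

lemma subst_dual_exp_pair_args:
  fixes a b a' b' :: "('v::finite, ln_dual) mps"
  assumes f: "mps_subst f (\<lambda>v. dual_exp (mps_var v)) = dual_exp (mps_var 0 + mps_var 1)"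
    and a: "mps_subst a (\<lambda>v. dual_exp (mps_var v)) = dual_exp a'"
    and b: "mps_subst b (\<lambda>v. dual_exp (mps_var v)) = dual_exp b'"
    and zero: "mps_coeff a {#} = 0" "mps_coeff b {#} = 0" "mps_coeff a' {#} = 0" "mps_coeff b' {#} = 0"
  shows "mps_subst (mps_subst f (pair_args a b)) (\<lambda>v. dual_exp (mps_var v)) = dual_exp (a' + b')"
proof -
  have "(\<lambda>u. mps_subst (pair_args a b u) (\<lambda>v. dual_exp (mps_var v))) =
      pair_args (dual_exp a') (dual_exp b')"
    using a b by (auto simp: pair_args_def)
  hence "mps_subst (mps_subst f (pair_args a b)) (\<lambda>v. dual_exp (mps_var v)) =
      mps_subst f (pair_args (dual_exp a') (dual_exp b'))"
    by (simp add: mps_subst_subst mps_coeff_pair_args_empty zero)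
  also have "\<dots> = dual_exp (a' + b')"
    by (rule subst_pair_args_dual_exp[OF f zero(3,4)])
  finally show ?thesis .
qed

theorem corollary1:
  fixes \<alpha> :: "nat \<Rightarrow> nat \<Rightarrow> ln_dual" and f :: "(2, ln_dual) mps"
  assumes "f = normalized_series \<alpha>"
    and "geometric_cobordism series_act {F. series_homogeneous 2 F} f"
  shows "commutative_formal_group_law f"
proof -
  have f0: "mps_coeff f {#} = 0"
    by (simp add: assms(1) normalized_series_def mps_coeff_mps_var)
  note f = subst_dual_exp_eq[OF assms]
  note law = subst_dual_exp_pair_args[OF f]
  note var = mps_subst_var_dual_exp
  \<comment> \<open>The argument 0 fits \<open>law\<close> because it is
    \<open>dual_exp 0\<close>.\<close>
  note zero = trans[OF mps_subst_zero dual_exp_zero[symmetric]]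
  note const = mps_coeff_mps_var mps_coeff_subst_empty f0
  show ?thesis
    unfolding commutative_formal_group_law_def
  \<comment> \<open>After the injective substitution, \<open>law\<close> turns both sides of each
    axiom into \<open>dual_exp\<close> of a sum of variables.\<close>
  proof (intro conjI; rule dual_exp_vars_inject)
    show "mps_subst (mps_subst f (pair_args (mps_var 0) 0)) (\<lambda>v. dual_exp (mps_var v)) = mps_subst (mps_var 0 :: (2, ln_dual) mps) (\<lambda>v. dual_exp (mps_var v))"
      by (subst law[OF var zero]) (simp_all add: const var)
    show "mps_subst (mps_subst f (pair_args 0 (mps_var 1))) (\<lambda>v. dual_exp (mps_var v)) = mps_subst (mps_var 1 :: (2, ln_dual) mps) (\<lambda>v. dual_exp (mps_var v))"
      by (subst law[OF zero var]) (simp_all add: const var)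
    show "mps_subst (mps_subst f (pair_args (mps_var 1) (mps_var 0))) (\<lambda>v. dual_exp (mps_var v)) = mps_subst f (\<lambda>v. dual_exp (mps_var v))"
      by (subst law[OF var var]) (simp_all add: const f add.commute)
    show "mps_subst (mps_subst f (pair_args (mps_subst f (pair_args (mps_var 0) (mps_var 1))) (mps_var 2))) (\<lambda>v. dual_exp (mps_var v)) =
      mps_subst (mps_subst f (pair_args (mps_var 0) (mps_subst f (pair_args (mps_var 1) (mps_var 2)))) :: (3, ln_dual) mps) (\<lambda>v. dual_exp (mps_var v))"
    proof -
      have "mps_subst (mps_subst f (pair_args (mps_subst f (pair_args (mps_var 0) (mps_var 1))) (mps_var 2))) (\<lambda>v. dual_exp (mps_var v)) =
          dual_exp (mps_var 0 + mps_var 1 + mps_var (2 :: 3))"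
        \<comment> \<open>The sum produced by the inner occurrence of \<open>f\<close> serves as
          \<open>a'\<close> for the outer one.\<close>
        by (rule law[OF law[OF var var] var]) (simp_all add: const)
      also have "\<dots> = mps_subst (mps_subst f
          (pair_args (mps_var 0) (mps_subst f (pair_args (mps_var 1) (mps_var 2))))) (\<lambda>v. dual_exp (mps_var v))"
        unfolding add.assoc by (rule law[OF var law[OF var var], symmetric]) (simp_all add: const)
      finally show ?thesis .
    qed
  qed
qed

end
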